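(* Let $k$ be a commutative ring. The category $\mathcal{T}$ of finite rooted trees admits a generalized Reedy structure, given by the subcategories $\mathcal{T}^+$, $\mathcal{T}^-$ and the degree map $d(A)=|A|$. Moreover, its standard modules $\Delta_A$ ($A\in\mathrm{Ob}(\mathcal{T})$) are projective and form a family of projective generators of the category $\mathcal{T}\text{-}\mathrm{Mod}$.
   Context: Rooted trees: a finite rooted tree is a finite poset $(A,\leqslant)$ with a unique minimal element (the root) such that for every $x\in A$ the set $\{y\in A\mid y\leqslant x\}$ is a chain. Its edges are the covering relations $a\lessdot b$. An embedding $f:A\to B$ is an injective map with $x\leqslant y\iff f(x)\leqslant f(y)$. For an edge $a\lessdot b$ of $A$, $A/\{a,b\}$ is the rooted tree obtained by contracting the edge (identify $a$ and $b$, with the smallest partial order making the quotient map $\pi:A\to A/\{a,b\}$ order-preserving). An elementary contraction is a map of the form $\alpha\circ\pi$ with $\alpha$ an isomorphism of posets. The edge $a\lessdot b$, and the corresponding elementary contraction, are admissible if $a$ is the root of $A$ or $b$ is the unique immediate successor of $a$. $\mathcal{T}$ is the category whose objects are finite rooted trees and whose morphisms are the finite composites of embeddings (including isomorphisms) and admissible elementary contractions. $\mathcal{T}^+$ is the wide subcategory of embeddings; $\mathcal{T}^-$ is the wide subcategory of isomorphisms and admissible contractions (finite composites of admissible elementary contractions). $\mathcal{T}$ is replaced by a full skeleton where necessary. Generalized Reedy structure: a skeletal category $\mathcal{C}$ with $d:\mathrm{Ob}(\mathcal{C})\to\mathbb{N}$ and wide subcategories $\mathcal{C}^\pm$ such that: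 (1) $\mathcal{C}^+(x,y)\neq\varnothing$ only if $x=y$ or $d(x)<d(y)$; (2) $\mathcal{C}^-(x,y)\neq\varnothing$ only if $x=y$ or $d(x)>d(y)$; (3) $\mathcal{C}^+(x,x)=\mathcal{C}^-(x,x)=\mathrm{Aut}(x)$; (4) every morphism $f$ factors as $f=f^+\circ f^-$ with $f^\pm\in\mathcal{C}^\pm$, uniquely up to automorphisms of the intermediate object. A $\mathcal{T}$-module is a covariant functor from $\mathcal{T}$ to $k$-modules. $P_A=k\mathcal{T}(A,-)$, $\mathfrak{I}_A\subseteq P_A$ is the submodule generated by the non-invertible morphisms in $\mathcal{T}^-$ with source $A$, and $\Delta_A=P_A/\mathfrak{I}_A$ is the standard module. *)

theory Defs
  imports "HOL-Algebra.Module" "HOL-Algebra.AbelCoset"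
begin

section \<open>Categories\<close>

text \<open>Hom-sets need not be disjoint, so composition receives the objects involved:
  \<open>Cmp C x y z g f\<close> is \<open>g \<circ> f\<close> for \<open>f : x \<rightarrow> y\<close> and \<open>g : y \<rightarrow> z\<close>.\<close>

record ('o, 'a) cat =
  Obj :: "'o set"
  Hom :: "'o \<Rightarrow> 'o \<Rightarrow> 'a set"
  Cmp :: "'o \<Rightarrow> 'o \<Rightarrow> 'o \<Rightarrow> 'a \<Rightarrow> 'a \<Rightarrow> 'a"
  Idn :: "'o \<Rightarrow> 'a"

locale category =
  fixes C :: "('o, 'a) cat"
  assumes Idn_in_Hom: "x \<in> Obj C \<Longrightarrow> Idn C x \<in> Hom C x x"
    and Cmp_in_Hom:
      "\<lbrakk>x \<in> Obj C; y \<in> Obj C; z \<in> Obj C; f \<in> Hom C x y; g \<in> Hom C y z\<rbrakk>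
        \<Longrightarrow> Cmp C x y z g f \<in> Hom C x z"
    and Cmp_Idn_right:
      "\<lbrakk>x \<in> Obj C; y \<in> Obj C; f \<in> Hom C x y\<rbrakk> \<Longrightarrow> Cmp C x x y f (Idn C x) = f"
    and Cmp_Idn_left:
      "\<lbrakk>x \<in> Obj C; y \<in> Obj C; f \<in> Hom C x y\<rbrakk> \<Longrightarrow> Cmp C x y y (Idn C y) f = f"
    and Cmp_assoc:
      "\<lbrakk>w \<in> Obj C; x \<in> Obj C; y \<in> Obj C; z \<in> Obj C;
        f \<in> Hom C w x; g \<in> Hom C x y; h \<in> Hom C y z\<rbrakk>
        \<Longrightarrow> Cmp C w y z h (Cmp C w x y g f) = Cmp C w x z (Cmp C x y z h g) f"

definition invertible :: "('o, 'a) cat \<Rightarrow> 'o \<Rightarrow> 'o \<Rightarrow> 'a \<Rightarrow> bool" where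
  "invertible C x y f \<longleftrightarrow> f \<in> Hom C x y \<and>
     (\<exists>g \<in> Hom C y x. Cmp C x y x g f = Idn C x \<and> Cmp C y x y f g = Idn C y)"

definition Aut :: "('o, 'a) cat \<Rightarrow> 'o \<Rightarrow> 'a set" where
  "Aut C x = {f. invertible C x x f}"

definition isomorphic :: "('o, 'a) cat \<Rightarrow> 'o \<Rightarrow> 'o \<Rightarrow> bool" where
  "isomorphic C x y \<longleftrightarrow> (\<exists>f. invertible C x y f)"

definition skeletal :: "('o, 'a) cat \<Rightarrow> bool" where
  "skeletal C \<longleftrightarrow> (\<forall>x \<in> Obj C. \<forall>y \<in> Obj C. isomorphic C x y \<longrightarrow> x = y)"

definition full_subcat :: "('o, 'a) cat \<Rightarrow> 'o set \<Rightarrow> ('o, 'a) cat" where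
  "full_subcat C S = C\<lparr>Obj := S\<rparr>"

text \<open>\<open>S\<close> is the set of objects of a full skeleton of \<open>C\<close>.\<close>

definition skeleton :: "('o, 'a) cat \<Rightarrow> 'o set \<Rightarrow> bool" where
  "skeleton C S \<longleftrightarrow> S \<subseteq> Obj C \<and> (\<forall>x \<in> Obj C. \<exists>!y. y \<in> S \<and> isomorphic C x y)"

lemma (in category) skeleton_exists: "\<exists>S. skeleton C S"
proof -
  have refl: "isomorphic C x x" if "x \<in> Obj C" for x
    unfolding isomorphic_def invertible_def
    using that Idn_in_Hom Cmp_Idn_left by blast
  have sym: "isomorphic C y x" if "isomorphic C x y" for x y
    using that unfolding isomorphic_def invertible_def by blast
  have trans: "isomorphic C x z"
    if obj: "x \<in> Obj C" "y \<in> Obj C" "z \<in> Obj C" and xy: "isomorphic C x y" and yz: "isomorphic C y z" for x y z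
  proof -
    obtain f f' where f: "f \<in> Hom C x y" "f' \<in> Hom C y x"
        "Cmp C x y x f' f = Idn C x" "Cmp C y x y f f' = Idn C y"
      using xy unfolding isomorphic_def invertible_def by blast
    obtain g g' where g: "g \<in> Hom C y z" "g' \<in> Hom C z y"
        "Cmp C y z y g' g = Idn C y" "Cmp C z y z g g' = Idn C z"
      using yz unfolding isomorphic_def invertible_def by blast
    have "Cmp C x z x (Cmp C z y x f' g') (Cmp C x y z g f) = Idn C x"
      using Cmp_assoc[of x y z x f g "Cmp C z y x f' g'"] Cmp_assoc[of y z y x g g' f']
        f g obj Cmp_in_Hom Cmp_Idn_right by metis
    moreover have "Cmp C z x z (Cmp C x y z g f) (Cmp C z y x f' g') = Idn C z"
      using Cmp_assoc[of z y x z g' f' "Cmp C x y z g f"] Cmp_assoc[of y x y z f' f g]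
        f g obj Cmp_in_Hom Cmp_Idn_right by metis
    ultimately show ?thesis
      unfolding isomorphic_def invertible_def using Cmp_in_Hom f g obj by meson
  qed
  define r where "r x = (SOME y. y \<in> Obj C \<and> isomorphic C x y)" for x
  have r: "r x \<in> Obj C \<and> isomorphic C x (r x)" if "x \<in> Obj C" for x
    unfolding r_def by (rule someI[of _ x]) (use that refl in blast)
  have r_eq: "r x = r y" if "x \<in> Obj C" "y \<in> Obj C" "isomorphic C x y" for x y
  proof -
    have "(z \<in> Obj C \<and> isomorphic C x z) = (z \<in> Obj C \<and> isomorphic C y z)" for z
      using that sym trans by metis
    then show ?thesis unfolding r_def by simp
  qed
  have "skeleton C (r ` Obj C)"
    unfolding skeleton_def using r r_eq by (smt (verit, best) image_iff subsetI)
  then show ?thesis ..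
qed

definition wide_subcategory :: "('o, 'a) cat \<Rightarrow> ('o \<Rightarrow> 'o \<Rightarrow> 'a set) \<Rightarrow> bool" where
  "wide_subcategory C H \<longleftrightarrow>
     (\<forall>x \<in> Obj C. \<forall>y \<in> Obj C. H x y \<subseteq> Hom C x y) \<and>
     (\<forall>x \<in> Obj C. Idn C x \<in> H x x) \<and>
     (\<forall>x \<in> Obj C. \<forall>y \<in> Obj C. \<forall>z \<in> Obj C. \<forall>f \<in> H x y. \<forall>g \<in> H y z. Cmp C x y z g f \<in> H x z)"

definition generalized_reedy ::
  "('o, 'a) cat \<Rightarrow> ('o \<Rightarrow> nat) \<Rightarrow> ('o \<Rightarrow> 'o \<Rightarrow> 'a set) \<Rightarrow> ('o \<Rightarrow> 'o \<Rightarrow> 'a set) \<Rightarrow> bool" where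
  "generalized_reedy C d Cp Cm \<longleftrightarrow>
     category C \<and> skeletal C \<and> wide_subcategory C Cp \<and> wide_subcategory C Cm \<and>
     (\<forall>x \<in> Obj C. \<forall>y \<in> Obj C. Cp x y \<noteq> {} \<longrightarrow> x = y \<or> d x < d y) \<and>
     (\<forall>x \<in> Obj C. \<forall>y \<in> Obj C. Cm x y \<noteq> {} \<longrightarrow> x = y \<or> d x > d y) \<and>
     (\<forall>x \<in> Obj C. Cp x x = Aut C x \<and> Cm x x = Aut C x) \<and>
     (\<forall>x \<in> Obj C. \<forall>y \<in> Obj C. \<forall>f \<in> Hom C x y.
        (\<exists>z \<in> Obj C. \<exists>p \<in> Cp z y. \<exists>m \<in> Cm x z. f = Cmp C x z y p m) \<and>
        (\<forall>z \<in> Obj C. \<forall>z' \<in> Obj C. \<forall>p \<in> Cp z y. \<forall>m \<in> Cm x z. \<forall>p' \<in> Cp z' y. \<forall>m' \<in> Cm x z'.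
           f = Cmp C x z y p m \<and> f = Cmp C x z' y p' m' \<longrightarrow>
           z = z' \<and>
           (\<exists>s \<in> Aut C z. m' = Cmp C x z z s m \<and> p = Cmp C z z y p' s)))"


section \<open>Modules over a category\<close>

definition mod_hom ::
  "('k, 'r) ring_scheme \<Rightarrow> ('k, 'm) module \<Rightarrow> ('k, 'n) module \<Rightarrow> ('m \<Rightarrow> 'n) set" where
  "mod_hom R M N =
     {f \<in> carrier M \<rightarrow> carrier N.
        (\<forall>x \<in> carrier M. \<forall>y \<in> carrier M. f (x \<oplus>\<^bsub>M\<^esub> y) = f x \<oplus>\<^bsub>N\<^esub> f y) \<and>
        (\<forall>r \<in> carrier R. \<forall>x \<in> carrier M. f (r \<odot>\<^bsub>M\<^esub> x) = r \<odot>\<^bsub>N\<^esub> f x)}"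

record ('o, 'a, 'k, 'm) cmod =
  val :: "'o \<Rightarrow> ('k, 'm) module"
  act :: "'o \<Rightarrow> 'o \<Rightarrow> 'a \<Rightarrow> 'm \<Rightarrow> 'm"

text \<open>Covariant functors from \<open>C\<close> to \<open>R\<close>-modules. All values have carriers in one type \<open>'m\<close>;
  for a set of objects this is no restriction, since \<open>'m\<close> is arbitrary.\<close>

locale cat_module = category C
  for C :: "('o, 'a) cat" and R :: "('k, 'r) ring_scheme" and M :: "('o, 'a, 'k, 'm) cmod" +
  assumes val_module: "x \<in> Obj C \<Longrightarrow> module R (val M x)"
    and act_hom:
      "\<lbrakk>x \<in> Obj C; y \<in> Obj C; f \<in> Hom C x y\<rbrakk> \<Longrightarrow> act M x y f \<in> mod_hom R (val M x) (val M y)"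
    and act_Idn:
      "\<lbrakk>x \<in> Obj C; u \<in> carrier (val M x)\<rbrakk> \<Longrightarrow> act M x x (Idn C x) u = u"
    and act_Cmp:
      "\<lbrakk>x \<in> Obj C; y \<in> Obj C; z \<in> Obj C; f \<in> Hom C x y; g \<in> Hom C y z; u \<in> carrier (val M x)\<rbrakk>
        \<Longrightarrow> act M x z (Cmp C x y z g f) u = act M y z g (act M x y f u)"

text \<open>Morphisms of \<open>C\<close>-modules. Their components are relevant on the carriers only.\<close>

definition nat_trans ::
  "('o, 'a) cat \<Rightarrow> ('k, 'r) ring_scheme \<Rightarrow> ('o, 'a, 'k, 'm) cmod \<Rightarrow> ('o, 'a, 'k, 'n) cmod
    \<Rightarrow> ('o \<Rightarrow> 'm \<Rightarrow> 'n) set" where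
  "nat_trans C R M N =
     {\<phi>. (\<forall>x \<in> Obj C. \<phi> x \<in> mod_hom R (val M x) (val N x)) \<and>
        (\<forall>x \<in> Obj C. \<forall>y \<in> Obj C. \<forall>f \<in> Hom C x y. \<forall>u \<in> carrier (val M x).
           \<phi> y (act M x y f u) = act N x y f (\<phi> x u))}"

definition epi :: "('o, 'a) cat \<Rightarrow> ('o, 'a, 'k, 'm) cmod \<Rightarrow> ('o, 'a, 'k, 'n) cmod
    \<Rightarrow> ('o \<Rightarrow> 'm \<Rightarrow> 'n) \<Rightarrow> bool" where
  "epi C M N \<phi> \<longleftrightarrow> (\<forall>x \<in> Obj C. \<phi> x ` carrier (val M x) = carrier (val N x))"

text \<open>The types \<open>'m\<close> and \<open>'n\<close> bound the universes from which the test modules are taken; a statement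
  about all \<open>C\<close>-modules leaves both as type variables.\<close>

definition projective ::
  "'m itself \<Rightarrow> 'n itself \<Rightarrow> ('o, 'a) cat \<Rightarrow> ('k, 'r) ring_scheme \<Rightarrow> ('o, 'a, 'k, 'p) cmod \<Rightarrow> bool" where
  "projective _ _ C R P \<longleftrightarrow> cat_module C R P \<and>
     (\<forall>(M :: ('o, 'a, 'k, 'm) cmod) (N :: ('o, 'a, 'k, 'n) cmod) e \<phi>.
        cat_module C R M \<and> cat_module C R N \<and> e \<in> nat_trans C R M N \<and> epi C M N e \<and>
        \<phi> \<in> nat_trans C R P N \<longrightarrow>
        (\<exists>\<psi> \<in> nat_trans C R P M. \<forall>x \<in> Obj C. \<forall>u \<in> carrier (val P x). e x (\<psi> x u) = \<phi> x u))"

text \<open>A family \<open>(G i)\<close>, \<open>i \<in> I\<close>, generates if morphisms out of its members separate parallel pairs.\<close>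

definition generating_family ::
  "'m itself \<Rightarrow> 'n itself \<Rightarrow> ('o, 'a) cat \<Rightarrow> ('k, 'r) ring_scheme \<Rightarrow> 'i set
    \<Rightarrow> ('i \<Rightarrow> ('o, 'a, 'k, 'p) cmod) \<Rightarrow> bool" where
  "generating_family _ _ C R I G \<longleftrightarrow> (\<forall>i \<in> I. cat_module C R (G i)) \<and>
     (\<forall>(M :: ('o, 'a, 'k, 'm) cmod) (N :: ('o, 'a, 'k, 'n) cmod) \<phi> \<psi>.
        cat_module C R M \<and> cat_module C R N \<and> \<phi> \<in> nat_trans C R M N \<and> \<psi> \<in> nat_trans C R M N \<and>
        (\<exists>x \<in> Obj C. \<exists>u \<in> carrier (val M x). \<phi> x u \<noteq> \<psi> x u) \<longrightarrow>
        (\<exists>i \<in> I. \<exists>h \<in> nat_trans C R (G i) M.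
           \<exists>x \<in> Obj C. \<exists>u \<in> carrier (val (G i) x). \<phi> x (h x u) \<noteq> \<psi> x (h x u)))"

definition projective_generators ::
  "'m itself \<Rightarrow> 'n itself \<Rightarrow> ('o, 'a) cat \<Rightarrow> ('k, 'r) ring_scheme \<Rightarrow> 'i set
    \<Rightarrow> ('i \<Rightarrow> ('o, 'a, 'k, 'p) cmod) \<Rightarrow> bool" where
  "projective_generators tm tn C R I G \<longleftrightarrow>
     (\<forall>i \<in> I. projective tm tn C R (G i)) \<and> generating_family tm tn C R I G"

definition submodule_family ::
  "('o, 'a) cat \<Rightarrow> ('k, 'r) ring_scheme \<Rightarrow> ('o, 'a, 'k, 'm) cmod \<Rightarrow> ('o \<Rightarrow> 'm set) \<Rightarrow> bool" where
  "submodule_family C R M N \<longleftrightarrow>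
     (\<forall>x \<in> Obj C. submodule (N x) R (val M x)) \<and>
     (\<forall>x \<in> Obj C. \<forall>y \<in> Obj C. \<forall>f \<in> Hom C x y. act M x y f ` N x \<subseteq> N y)"

definition generated_submodule ::
  "('o, 'a) cat \<Rightarrow> ('k, 'r) ring_scheme \<Rightarrow> ('o, 'a, 'k, 'm) cmod \<Rightarrow> ('o \<Rightarrow> 'm set) \<Rightarrow> 'o \<Rightarrow> 'm set" where
  "generated_submodule C R M X x =
     \<Inter> {N x | N. submodule_family C R M N \<and> (\<forall>y \<in> Obj C. X y \<subseteq> N y)}"

text \<open>The ring operations \<open>mult\<close> and \<open>one\<close> of the record type are not used by modules.\<close>

definition quotient_module :: "('k, 'm) module \<Rightarrow> 'm set \<Rightarrow> ('k, 'm set) module" where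
  "quotient_module M N =
     \<lparr>carrier = a_rcosets\<^bsub>M\<^esub> N, mult = undefined, one = undefined,
      zero = N, add = (<+>\<^bsub>M\<^esub>), smult = (\<lambda>r X. N <+>\<^bsub>M\<^esub> ((\<lambda>u. r \<odot>\<^bsub>M\<^esub> u) ` X))\<rparr>"

definition quotient_cmod ::
  "('o, 'a, 'k, 'm) cmod \<Rightarrow> ('o \<Rightarrow> 'm set) \<Rightarrow> ('o, 'a, 'k, 'm set) cmod" where
  "quotient_cmod M N =
     \<lparr>val = (\<lambda>x. quotient_module (val M x) (N x)),
      act = (\<lambda>x y f X. N y <+>\<^bsub>val M y\<^esub> (act M x y f ` X))\<rparr>"

definition free_module :: "('k, 'r) ring_scheme \<Rightarrow> 'a set \<Rightarrow> ('k, 'a \<Rightarrow> 'k) module" where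
  "free_module R B =
     \<lparr>carrier = {u. (\<forall>b. u b \<in> carrier R) \<and> (\<forall>b. b \<notin> B \<longrightarrow> u b = \<zero>\<^bsub>R\<^esub>) \<and> finite {b. u b \<noteq> \<zero>\<^bsub>R\<^esub>}},
      mult = undefined, one = undefined,
      zero = (\<lambda>b. \<zero>\<^bsub>R\<^esub>), add = (\<lambda>u v b. u b \<oplus>\<^bsub>R\<^esub> v b), smult = (\<lambda>r u b. r \<otimes>\<^bsub>R\<^esub> u b)\<rparr>"

definition basis_elem :: "('k, 'r) ring_scheme \<Rightarrow> 'a \<Rightarrow> 'a \<Rightarrow> 'k" where
  "basis_elem R f = (\<lambda>g. if g = f then \<one>\<^bsub>R\<^esub> else \<zero>\<^bsub>R\<^esub>)"

text \<open>\<open>P\<^sub>x = R C(x, -)\<close>: a morphism \<open>g : y \<rightarrow> z\<close> maps the basis element \<open>f : x \<rightarrow> y\<close> to \<open>g \<circ> f\<close>.\<close>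

definition rep_module ::
  "('o, 'a) cat \<Rightarrow> ('k, 'r) ring_scheme \<Rightarrow> 'o \<Rightarrow> ('o, 'a, 'k, 'a \<Rightarrow> 'k) cmod" where
  "rep_module C R x =
     \<lparr>val = (\<lambda>y. free_module R (Hom C x y)),
      act = (\<lambda>y z g u h. \<Oplus>\<^bsub>R\<^esub>f \<in> {f \<in> Hom C x y. u f \<noteq> \<zero>\<^bsub>R\<^esub> \<and> Cmp C x y z g f = h}. u f)\<rparr>"

definition reedy_submodule ::
  "('o, 'a) cat \<Rightarrow> ('o \<Rightarrow> 'o \<Rightarrow> 'a set) \<Rightarrow> ('k, 'r) ring_scheme \<Rightarrow> 'o \<Rightarrow> 'o \<Rightarrow> ('a \<Rightarrow> 'k) set" where
  "reedy_submodule C Cm R x =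
     generated_submodule C R (rep_module C R x)
       (\<lambda>y. {basis_elem R f | f. f \<in> Cm x y \<and> \<not> invertible C x y f})"

definition standard_module ::
  "('o, 'a) cat \<Rightarrow> ('o \<Rightarrow> 'o \<Rightarrow> 'a set) \<Rightarrow> ('k, 'r) ring_scheme \<Rightarrow> 'o
    \<Rightarrow> ('o, 'a, 'k, ('a \<Rightarrow> 'k) set) cmod" where
  "standard_module C Cm R x = quotient_cmod (rep_module C R x) (reedy_submodule C Cm R x)"


section \<open>Finite rooted trees\<close>

text \<open>A poset is given by its reflexive order relation \<open>A\<close>; its underlying set is \<open>Field A\<close>.\<close>

definition is_root :: "'v rel \<Rightarrow> 'v \<Rightarrow> bool" where
  "is_root A x \<longleftrightarrow> x \<in> Field A \<and> (\<forall>y. (y, x) \<in> A \<longrightarrow> y = x)"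

definition rooted_tree :: "'v rel \<Rightarrow> bool" where
  "rooted_tree A \<longleftrightarrow> finite (Field A) \<and> Partial_order A \<and> (\<exists>!x. is_root A x) \<and>
     (\<forall>x \<in> Field A. {y \<in> Field A. (y, x) \<in> A} \<in> Chains A)"

definition edge :: "'v rel \<Rightarrow> 'v \<Rightarrow> 'v \<Rightarrow> bool" where
  "edge A a b \<longleftrightarrow> (a, b) \<in> A \<and> a \<noteq> b \<and> (\<forall>c. (a, c) \<in> A \<and> (c, b) \<in> A \<longrightarrow> c = a \<or> c = b)"

text \<open>Maps are made extensional outside \<open>Field A\<close>, so that equality of maps is equality in HOL.\<close>

definition embedding :: "'v rel \<Rightarrow> 'w rel \<Rightarrow> ('v \<Rightarrow> 'w) \<Rightarrow> bool" where
  "embedding A B f \<longleftrightarrow> f \<in> Field A \<rightarrow>\<^sub>E Field B \<and> inj_on f (Field A) \<and>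
     (\<forall>x \<in> Field A. \<forall>y \<in> Field A. (x, y) \<in> A \<longleftrightarrow> (f x, f y) \<in> B)"

definition poset_iso :: "'v rel \<Rightarrow> 'w rel \<Rightarrow> ('v \<Rightarrow> 'w) \<Rightarrow> bool" where
  "poset_iso A B f \<longleftrightarrow> embedding A B f \<and> f ` Field A = Field B"

lemma rooted_tree_on_nat:
  fixes A :: "'v rel"
  assumes "rooted_tree A"
  shows "\<exists>(B :: nat rel) f. rooted_tree B \<and> poset_iso A B f"
proof -
  have fin: "finite (Field A)" and po: "Partial_order A"
    and chain: "\<And>x y z. (y, x) \<in> A \<Longrightarrow> (z, x) \<in> A \<Longrightarrow> (y, z) \<in> A \<or> (z, y) \<in> A"
    using assms by (auto simp: rooted_tree_def Chains_def Field_def)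
  obtain r where r: "is_root A r" "\<And>x. is_root A x \<Longrightarrow> x = r"
    using assms by (auto simp: rooted_tree_def)
  obtain h :: "'v \<Rightarrow> nat" where h: "inj_on h (Field A)"
    using finite_imp_inj_to_nat_seg[OF fin] by blast
  define B where "B = map_prod h h ` A"
  have FB: "Field B = h ` Field A"
    unfolding B_def Field_def Domain_fst Range_snd by (auto simp: image_image image_Un)
  have B_iff: "(h x, h y) \<in> B \<longleftrightarrow> (x, y) \<in> A" if "x \<in> Field A" "y \<in> Field A" for x y
  proof
    assume "(h x, h y) \<in> B"
    then obtain x' y' where "(x', y') \<in> A" "h x = h x'" "h y = h y'"
      by (auto simp: B_def)
    then show "(x, y) \<in> A"
      using that h by (metis FieldI1 FieldI2 inj_onD)
  qed (auto simp: B_def)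
  have B_D: "\<exists>x \<in> Field A. \<exists>y \<in> Field A. u = h x \<and> v = h y \<and> (x, y) \<in> A" if "(u, v) \<in> B" for u v
    using that by (auto simp: B_def intro: FieldI1 FieldI2)
  have A_refl: "(x, x) \<in> A" if "x \<in> Field A" for x
    using po that by (auto simp: partial_order_on_def preorder_on_def refl_on_def)
  have "refl_on (Field B) B"
    by (auto simp: refl_on_def FB B_iff A_refl)
  moreover have "trans B"
  proof (rule transI)
    fix u v w assume "(u, v) \<in> B" "(v, w) \<in> B"
    then obtain x y y' z where "x \<in> Field A" "y \<in> Field A" "y' \<in> Field A" "z \<in> Field A"
      "u = h x" "v = h y" "v = h y'" "w = h z" "(x, y) \<in> A" "(y', z) \<in> A"
      using B_D by blast
    moreover from this have "y = y'" using h by (auto dest: inj_onD)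
    moreover have "trans A" using po by (auto simp: partial_order_on_def preorder_on_def)
    ultimately show "(u, w) \<in> B" by (metis B_iff transD)
  qed
  moreover have "antisym B"
  proof (rule antisymI)
    fix u v assume uv: "(u, v) \<in> B" "(v, u) \<in> B"
    then obtain x y where xy: "x \<in> Field A" "y \<in> Field A" "u = h x" "v = h y" "(x, y) \<in> A"
      using B_D by blast
    then have "(y, x) \<in> A" using uv B_iff by blast
    then have "x = y" using xy po by (auto simp: partial_order_on_def antisym_def)
    then show "u = v" using xy by simp
  qed
  ultimately have "Partial_order B"
    by (auto simp: partial_order_on_def preorder_on_def intro: FieldI1 FieldI2)
  moreover have root: "is_root B (h x) \<longleftrightarrow> is_root A x" if x: "x \<in> Field A" for x
  proof
    assume B: "is_root B (h x)"
    have "y = x" if "(y, x) \<in> A" for y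
    proof -
      have y: "y \<in> Field A" using that by (rule FieldI1)
      then have "h y = h x" using B B_iff x that by (auto simp: is_root_def)
      then show ?thesis using h x y by (auto dest: inj_onD)
    qed
    then show "is_root A x" using x by (auto simp: is_root_def)
  next
    assume A: "is_root A x"
    have "u = h x" if u: "(u, h x) \<in> B" for u
    proof -
      obtain y where "y \<in> Field A" "u = h y" using B_D[OF u] by blast
      then show ?thesis using A B_iff x u by (auto simp: is_root_def)
    qed
    then show "is_root B (h x)" using x by (auto simp: is_root_def FB)
  qed
  have "\<exists>!u. is_root B u"
  proof
    have "r \<in> Field A" using r(1) by (simp add: is_root_def)
    then show "is_root B (h r)" using root r(1) by blast
    show "u = h r" if u: "is_root B u" for u
    proof -
      obtain x where x: "x \<in> Field A" "u = h x" using u by (auto simp: is_root_def FB)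
      then have "x = r" using root[OF x(1)] r(2) u by blast
      then show ?thesis using x by simp
    qed
  qed
  moreover have "{v \<in> Field B. (v, u) \<in> B} \<in> Chains B" if "u \<in> Field B" for u
    using that by (auto simp: Chains_def FB B_iff dest: chain)
  ultimately have "rooted_tree B"
    using fin by (auto simp: rooted_tree_def FB)
  moreover have "poset_iso A B (restrict h (Field A))"
    using h by (auto simp: poset_iso_def embedding_def FB B_iff inj_on_def)
  ultimately show ?thesis by blast
qed

definition contract_map :: "'v \<Rightarrow> 'v \<Rightarrow> 'v \<Rightarrow> 'v set" where
  "contract_map a b x = (if x = a \<or> x = b then {a, b} else {x})"

text \<open>The smallest partial order on the vertex set of the quotient for which the quotient map is
  order-preserving, obtained as the intersection of all of them.\<close>

definition contract :: "'v rel \<Rightarrow> 'v \<Rightarrow> 'v \<Rightarrow> 'v set rel" where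
  "contract A a b =
     \<Inter> {Q. partial_order_on (contract_map a b ` Field A) Q \<and>
          (\<forall>(x, y) \<in> A. (contract_map a b x, contract_map a b y) \<in> Q)}"

definition admissible_edge :: "'v rel \<Rightarrow> 'v \<Rightarrow> 'v \<Rightarrow> bool" where
  "admissible_edge A a b \<longleftrightarrow> edge A a b \<and> (is_root A a \<or> (\<forall>c. edge A a c \<longrightarrow> c = b))"

definition admissible_contraction :: "'v rel \<Rightarrow> 'w rel \<Rightarrow> ('v \<Rightarrow> 'w) \<Rightarrow> bool" where
  "admissible_contraction A B f \<longleftrightarrow>
     (\<exists>a b \<alpha>. admissible_edge A a b \<and> poset_iso (contract A a b) B \<alpha> \<and>
        f = compose (Field A) \<alpha> (contract_map a b))"

inductive tree_mor :: "'v rel \<Rightarrow> 'v rel \<Rightarrow> ('v \<Rightarrow> 'v) \<Rightarrow> bool" where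
  emb: "\<lbrakk>rooted_tree A; rooted_tree B; embedding A B f\<rbrakk> \<Longrightarrow> tree_mor A B f"
| contr: "\<lbrakk>rooted_tree A; rooted_tree B; admissible_contraction A B f\<rbrakk> \<Longrightarrow> tree_mor A B f"
| comp: "\<lbrakk>tree_mor A B f; tree_mor B D g\<rbrakk> \<Longrightarrow> tree_mor A D (compose (Field A) g f)"

inductive tree_mor_minus :: "'v rel \<Rightarrow> 'v rel \<Rightarrow> ('v \<Rightarrow> 'v) \<Rightarrow> bool" where
  iso: "\<lbrakk>rooted_tree A; rooted_tree B; poset_iso A B f\<rbrakk> \<Longrightarrow> tree_mor_minus A B f"
| contr: "\<lbrakk>rooted_tree A; rooted_tree B; admissible_contraction A B f\<rbrakk> \<Longrightarrow> tree_mor_minus A B f"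
| comp: "\<lbrakk>tree_mor_minus A B f; tree_mor_minus B D g\<rbrakk>
    \<Longrightarrow> tree_mor_minus A D (compose (Field A) g f)"

text \<open>The category of finite rooted trees, with vertices taken from \<^typ>\<open>nat\<close>; by
  \<open>rooted_tree_on_nat\<close> below this loses no tree up to isomorphism.\<close>

definition Tree_cat :: "(nat rel, nat \<Rightarrow> nat) cat" where
  "Tree_cat =
     \<lparr>Obj = {A. rooted_tree A},
      Hom = (\<lambda>A B. {f. tree_mor A B f}),
      Cmp = (\<lambda>A B D g f. compose (Field A) g f),
      Idn = (\<lambda>A. restrict id (Field A))\<rparr>"

definition Tree_plus :: "nat rel \<Rightarrow> nat rel \<Rightarrow> (nat \<Rightarrow> nat) set" where
  "Tree_plus A B = {f. rooted_tree A \<and> rooted_tree B \<and> embedding A B f}"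

definition Tree_minus :: "nat rel \<Rightarrow> nat rel \<Rightarrow> (nat \<Rightarrow> nat) set" where
  "Tree_minus A B = {f. tree_mor_minus A B f}"

definition tree_degree :: "nat rel \<Rightarrow> nat" where
  "tree_degree A = card (Field A)"

end

theory Submission
  imports Defs
begin

text \<open>
  The Reedy structure rests on the fact that admissible contractions can be restricted to
  subtrees. If a tree is cut down to a set of vertices with a least element, the restriction of an
  admissible contraction is either an admissible contraction or an isomorphism onto its image
  (\<open>collapses_restrict\<close>); for other edges this may fail. Consequently every composite
  of embeddings and admissible contractions is a composite of isomorphisms and admissible
  contractions onto its image (\<open>tree_mor_onto_image\<close>), followed by an inclusion. The
  factorization is unique because the intermediate tree is a copy of the image.

  Morphisms from the standard module of \<open>A\<close> to a module \<open>M\<close> correspond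
  to the elements of \<open>M A\<close> that are annihilated by all non-invertible morphisms in
  \<open>Tree_minus\<close> (\<open>standard_generator_killed\<close>,
  \<open>standard_hom_exists\<close>, \<open>standard_hom_eqI\<close>). For every admissible edge
  \<open>(a, b)\<close> of \<open>A\<close> there is an idempotent endomorphism of
  \<open>A\<close> that moves \<open>b\<close> to \<open>a\<close>. It is the contraction of the
  edge followed by an embedding, and the contraction is unchanged when preceded by it, so both
  annihilate the same elements. An arbitrary element of \<open>M A\<close> can be made into an
  annihilated one by applying \<open>1 - p\<close> for these idempotents \<open>p\<close>, one
  after the other. If the edges are treated from the root upwards, no step destroys what was
  achieved before (\<open>retraction_braid\<close>, \<open>exists_annihilated\<close>); this is
  the argument that normalizes (co)simplicial objects in the Dold-Kan correspondence.

  Projectivity follows by correcting an arbitrary preimage of the given annihilated element: the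
  corrections have image zero. The standard modules generate because the corrections come from
  smaller trees: at a smallest tree where two morphisms differ, an element that separates them can
  be corrected to an annihilated one that still does.
\<close>


section \<open>Finite rooted trees and their subtrees\<close>

lemma po_refl: "Partial_order A \<Longrightarrow> x \<in> Field A \<Longrightarrow> (x, x) \<in> A"
  by (auto simp: partial_order_on_def preorder_on_def refl_on_def)

lemma po_trans: "Partial_order A \<Longrightarrow> (x, y) \<in> A \<Longrightarrow> (y, z) \<in> A \<Longrightarrow> (x, z) \<in> A"
  by (auto simp: partial_order_on_def preorder_on_def dest: transD)

lemma po_antisym: "Partial_order A \<Longrightarrow> (x, y) \<in> A \<Longrightarrow> (y, x) \<in> A \<Longrightarrow> x = y"
  by (auto simp: partial_order_on_def dest: antisymD)

lemma partial_order_onI: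
  assumes "A \<subseteq> X \<times> X"
    and "\<And>x. x \<in> X \<Longrightarrow> (x, x) \<in> A"
    and "\<And>x y z. (x, y) \<in> A \<Longrightarrow> (y, z) \<in> A \<Longrightarrow> (x, z) \<in> A"
    and "\<And>x y. (x, y) \<in> A \<Longrightarrow> (y, x) \<in> A \<Longrightarrow> x = y"
  shows "partial_order_on X A"
  unfolding partial_order_on_def preorder_on_def
  using assms by (auto simp: refl_on_def intro: transI antisymI)

lemma finite_minimal:
  assumes "Partial_order A" "finite X" "X \<noteq> {}"
  shows "\<exists>m \<in> X. \<forall>x \<in> X. (x, m) \<in> A \<longrightarrow> x = m"
  using assms(2,3)
proof (induction X rule: finite_ne_induct)
  case (insert x F)
  then obtain m where m: "m \<in> F" "\<And>y. y \<in> F \<Longrightarrow> (y, m) \<in> A \<Longrightarrow> y = m" by blast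
  show ?case
  proof (cases "(x, m) \<in> A")
    case True
    have "y = x" if "y \<in> F" "(y, x) \<in> A" for y
      using m(2)[OF that(1)] po_trans[OF assms(1) that(2) True] po_antisym[OF assms(1)] that(2) True
      by blast
    then show ?thesis by blast
  next
    case False
    then show ?thesis using m by blast
  qed
qed simp

lemma finite_maximal:
  assumes "Partial_order A" "finite X" "X \<noteq> {}"
  shows "\<exists>m \<in> X. \<forall>x \<in> X. (m, x) \<in> A \<longrightarrow> x = m"
  using finite_minimal[of "A\<inverse>" X] assms by simp

lemma rooted_treeD:
  assumes "rooted_tree A"
  shows "finite (Field A)" "Partial_order A"
    and "\<And>x y z. (x, z) \<in> A \<Longrightarrow> (y, z) \<in> A \<Longrightarrow> (x, y) \<in> A \<or> (y, x) \<in> A"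
  using assms by (auto simp: rooted_tree_def Chains_def Field_def)

lemma root_least:
  assumes A: "rooted_tree A" and r: "is_root A r" and x: "x \<in> Field A"
  shows "(r, x) \<in> A"
proof -
  note po = rooted_treeD(2)[OF A]
  let ?X = "{y \<in> Field A. (y, x) \<in> A}"
  have "finite ?X" using rooted_treeD(1)[OF A] by simp
  moreover have "x \<in> ?X" using po_refl[OF po x] x by simp
  ultimately obtain m where m: "m \<in> ?X" "\<forall>y \<in> ?X. (y, m) \<in> A \<longrightarrow> y = m"
    using finite_minimal[OF po, of ?X] by blast
  have "y = m" if "(y, m) \<in> A" for y
    using m that po_trans[OF po that, of x] FieldI1[OF that] by simp
  then have "is_root A m" using m by (auto simp: is_root_def)
  then have "m = r" using A r unfolding rooted_tree_def by blast
  then show ?thesis using m by simp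
qed

lemma rooted_tree_least:
  assumes "rooted_tree A"
  obtains r where "r \<in> Field A" "\<And>x. x \<in> Field A \<Longrightarrow> (r, x) \<in> A"
  using assms root_least[OF assms] unfolding rooted_tree_def is_root_def by metis

lemma Field_Restr_tree: "rooted_tree B \<Longrightarrow> X \<subseteq> Field B \<Longrightarrow> Field (Restr B X) = X"
  using Refl_Field_Restr[of B X] rooted_treeD(2)[of B]
  by (auto simp: partial_order_on_def preorder_on_def)

lemma rooted_tree_Restr:
  assumes B: "rooted_tree B" and X: "X \<subseteq> Field B" and r: "r \<in> X" "\<And>x. x \<in> X \<Longrightarrow> (r, x) \<in> B"
  shows "rooted_tree (Restr B X)"
proof -
  note po = rooted_treeD(2)[OF B]
  have F: "Field (Restr B X) = X" using Field_Restr_tree[OF B X] .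
  have "Partial_order (Restr B X)"
    unfolding F
    by (rule partial_order_onI) (use po_refl[OF po] X in \<open>auto intro: po_trans[OF po] po_antisym[OF po]\<close>)
  moreover have "is_root (Restr B X) x \<longleftrightarrow> x = r" for x
    using r po_antisym[OF po] unfolding is_root_def F by auto
  moreover have "{y \<in> Field (Restr B X). (y, x) \<in> Restr B X} \<in> Chains (Restr B X)"
    if "x \<in> Field (Restr B X)" for x
    using rooted_treeD(3)[OF B] by (auto simp: Chains_def F)
  ultimately show ?thesis
    using rooted_treeD(1)[OF B] X by (auto simp: rooted_tree_def F finite_subset)
qed


section \<open>Embeddings and isomorphisms of posets\<close>

lemma embeddingI:
  assumes "Partial_order A" "f \<in> Field A \<rightarrow>\<^sub>E Field B"
    and iff: "\<And>x y. x \<in> Field A \<Longrightarrow> y \<in> Field A \<Longrightarrow> (f x, f y) \<in> B \<longleftrightarrow> (x, y) \<in> A"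
  shows "embedding A B f"
proof -
  have "inj_on f (Field A)"
  proof (rule inj_onI)
    fix x y assume "x \<in> Field A" "y \<in> Field A" "f x = f y"
    then show "x = y"
      using iff[of x y] iff[of y x] iff[of x x] po_refl[OF assms(1)] po_antisym[OF assms(1)] by metis
  qed
  then show ?thesis using assms unfolding embedding_def by blast
qed

lemma embedding_compose:
  "embedding A B f \<Longrightarrow> embedding B D g \<Longrightarrow> embedding A D (compose (Field A) g f)"
  unfolding embedding_def
  by (auto simp: compose_def PiE_iff inj_on_def extensional_def)

lemma poset_iso_compose:
  assumes "poset_iso A B f" "poset_iso B D g"
  shows "poset_iso A D (compose (Field A) g f)"
proof -
  have "compose (Field A) g f ` Field A = g ` f ` Field A" by (auto simp: compose_def)
  then show ?thesis using assms embedding_compose[of A B f D g] by (simp add: poset_iso_def)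
qed

lemma poset_iso_id: "poset_iso A A (restrict id (Field A))"
  by (auto simp: poset_iso_def embedding_def inj_on_def)

lemma poset_iso_inverse:
  assumes "poset_iso A B f"
  obtains g where "poset_iso B A g" "compose (Field A) g f = restrict id (Field A)"
    "compose (Field B) f g = restrict id (Field B)"
proof
  let ?g = "restrict (inv_into (Field A) f) (Field B)"
  have inj: "inj_on f (Field A)" and im: "f ` Field A = Field B"
    and iff: "\<And>x y. x \<in> Field A \<Longrightarrow> y \<in> Field A \<Longrightarrow> (x, y) \<in> A \<longleftrightarrow> (f x, f y) \<in> B"
    using assms by (auto simp: poset_iso_def embedding_def)
  have g: "?g u \<in> Field A" "f (?g u) = u" if "u \<in> Field B" for u
    using that im by (auto simp: inv_into_into f_inv_into_f)
  have gf: "?g (f x) = x" if "x \<in> Field A" for x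
    using that inj im by auto
  show "compose (Field A) ?g f = restrict id (Field A)"
    using gf by (auto simp: compose_def restrict_def fun_eq_iff)
  show "compose (Field B) f ?g = restrict id (Field B)"
    using g by (auto simp: compose_def restrict_def fun_eq_iff)
  have "(u, v) \<in> B \<longleftrightarrow> (?g u, ?g v) \<in> A" if "u \<in> Field B" "v \<in> Field B" for u v
    using iff[of "?g u" "?g v"] g that by metis
  moreover have "?g \<in> Field B \<rightarrow>\<^sub>E Field A" using g by auto
  moreover have "inj_on ?g (Field B)" using g(2) by (metis inj_onI)
  moreover have "?g ` Field B = Field A" using g gf im by force
  ultimately show "poset_iso B A ?g" by (simp add: poset_iso_def embedding_def)
qed

lemma embedding_card:
  assumes "rooted_tree A" "rooted_tree B" "embedding A B f"
  shows "poset_iso A B f \<or> card (Field A) < card (Field B)"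
proof -
  have fin: "finite (Field B)" using rooted_treeD(1)[OF assms(2)] .
  have *: "f ` Field A \<subseteq> Field B" "card (f ` Field A) = card (Field A)"
    using assms(3) by (auto simp: embedding_def card_image)
  show ?thesis
  proof (cases "f ` Field A = Field B")
    case True then show ?thesis using assms(3) by (simp add: poset_iso_def)
  next
    case False
    then show ?thesis using * psubset_card_mono[OF fin, of "f ` Field A"] by auto
  qed
qed


section \<open>Contractions of edges\<close>

text \<open>The preorder on the vertices of a tree that induces the order of the contracted tree: the only
  way to gain a relation is to pass once from \<open>b\<close> to \<open>a\<close>.\<close>

definition contract_le :: "'v rel \<Rightarrow> 'v \<Rightarrow> 'v \<Rightarrow> 'v \<Rightarrow> 'v \<Rightarrow> bool" where
  "contract_le A a b x y \<longleftrightarrow> (x, y) \<in> A \<or> (x, b) \<in> A \<and> (a, y) \<in> A"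

lemma contract_map_eq_iff:
  "contract_map a b x = contract_map a b y \<longleftrightarrow> x = y \<or> x \<in> {a, b} \<and> y \<in> {a, b}"
  by (auto simp: contract_map_def)

lemma edge_in_Field: "edge A a b \<Longrightarrow> a \<in> Field A \<and> b \<in> Field A"
  by (auto simp: edge_def intro: FieldI1 FieldI2)

lemma contract_le_trans:
  assumes "Partial_order A" "contract_le A a b x y" "contract_le A a b y z"
  shows "contract_le A a b x z"
  using assms(2,3) unfolding contract_le_def by (meson po_trans[OF assms(1)])

text \<open>Covering is what makes the contraction identify no further vertices: those that become
  equivalent to \<open>a\<close> and \<open>b\<close> lie between them.\<close>

lemma contract_le_antisym_iff:
  assumes po: "Partial_order A" and e: "edge A a b" and "x \<in> Field A" "y \<in> Field A"
  shows "contract_le A a b x y \<and> contract_le A a b y x \<longleftrightarrow> contract_map a b x = contract_map a b y"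
proof
  have between: "u \<in> {a, b}" if "(a, u) \<in> A" "(u, b) \<in> A" for u
    using e that by (auto simp: edge_def)
  have "x = y \<or> x \<in> {a, b} \<and> y \<in> {a, b}"
    if "contract_le A a b x y" "contract_le A a b y x"
    using that between[of x] between[of y] unfolding contract_le_def
    by (meson po_trans[OF po] po_antisym[OF po])
  then show "contract_map a b x = contract_map a b y"
    if "contract_le A a b x y \<and> contract_le A a b y x"
    using that by (simp add: contract_map_eq_iff)
  have "(a, b) \<in> A" "(a, a) \<in> A" "(b, b) \<in> A" "(x, x) \<in> A" "(y, y) \<in> A"
    using e edge_in_Field[OF e] po_refl[OF po] assms(3,4) by (auto simp: edge_def)
  then show "contract_le A a b x y \<and> contract_le A a b y x"
    if "contract_map a b x = contract_map a b y"
    using that unfolding contract_map_eq_iff contract_le_def by auto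
qed

text \<open>The induced relation is one of the partial orders over which \<open>contract\<close> takes the
  intersection, and each of them contains it, because there the classes of \<open>a\<close> and
  \<open>b\<close> are equal.\<close>

lemma contract_eq:
  assumes po: "Partial_order A" and e: "edge A a b"
  shows "contract A a b =
    {(contract_map a b x, contract_map a b y) | x y. x \<in> Field A \<and> y \<in> Field A \<and> contract_le A a b x y}"
    (is "_ = ?Q")
proof
  let ?p = "contract_map a b"
  have ab: "(a, b) \<in> A" "a \<in> Field A" "b \<in> Field A"
    using e edge_in_Field[OF e] by (auto simp: edge_def)
  have le: "contract_le A a b x y" if Q: "(?p x, ?p y) \<in> ?Q" and xy: "x \<in> Field A" "y \<in> Field A" for x y
  proof -
    obtain x' y' where *: "x' \<in> Field A" "y' \<in> Field A" "?p x = ?p x'" "?p y = ?p y'" "contract_le A a b x' y'"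
      using Q unfolding mem_Collect_eq prod.inject by blast
    then have "contract_le A a b x x'" "contract_le A a b y' y"
      using contract_le_antisym_iff[OF po e] xy by metis+
    then show ?thesis using *(5) contract_le_trans[OF po] by blast
  qed
  have "partial_order_on (?p ` Field A) ?Q"
  proof (rule partial_order_onI)
    show "?Q \<subseteq> ?p ` Field A \<times> ?p ` Field A" by auto
    show "(u, u) \<in> ?Q" if "u \<in> ?p ` Field A" for u
      using that po_refl[OF po] by (force simp: contract_le_def)
    show "(u, w) \<in> ?Q" if uv: "(u, v) \<in> ?Q" and vw: "(v, w) \<in> ?Q" for u v w
    proof -
      obtain x y z where "x \<in> Field A" "y \<in> Field A" "z \<in> Field A" "u = ?p x" "v = ?p y" "w = ?p z"
        using uv vw by auto
      moreover from this have "contract_le A a b x z"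
        using le[of x y] le[of y z] uv vw contract_le_trans[OF po] by metis
      ultimately show ?thesis by blast
    qed
    show "u = v" if uv: "(u, v) \<in> ?Q" and vu: "(v, u) \<in> ?Q" for u v
    proof -
      obtain x y where *: "x \<in> Field A" "y \<in> Field A" "u = ?p x" "v = ?p y"
        using uv by auto
      then show ?thesis
        using le[of x y] le[of y x] uv vu contract_le_antisym_iff[OF po e *(1,2)] by metis
    qed
  qed
  moreover have "\<forall>(x, y) \<in> A. (?p x, ?p y) \<in> ?Q"
    by (auto simp: contract_le_def intro: FieldI1 FieldI2)
  ultimately show "contract A a b \<subseteq> ?Q" unfolding contract_def by blast
  show "?Q \<subseteq> contract A a b"
  proof -
    have "(?p x, ?p y) \<in> Q"
      if Q: "partial_order_on (?p ` Field A) Q" and mono: "\<forall>(x, y) \<in> A. (?p x, ?p y) \<in> Q"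
        and le: "contract_le A a b x y" for Q x y
    proof -
      have "trans Q" using Q by (auto simp: partial_order_on_def preorder_on_def)
      moreover have "?p a = ?p b" by (simp add: contract_map_def)
      moreover have "(?p u, ?p v) \<in> Q" if "(u, v) \<in> A" for u v using mono that by auto
      ultimately show ?thesis
        using le unfolding contract_le_def by (metis transD)
    qed
    then show ?thesis unfolding contract_def by blast
  qed
qed

lemma contract_iff:
  assumes po: "Partial_order A" and e: "edge A a b" and xy: "x \<in> Field A" "y \<in> Field A"
  shows "(contract_map a b x, contract_map a b y) \<in> contract A a b \<longleftrightarrow> contract_le A a b x y"
proof
  assume "(contract_map a b x, contract_map a b y) \<in> contract A a b"
  then obtain x' y' where *: "x' \<in> Field A" "y' \<in> Field A"
    "contract_map a b x = contract_map a b x'" "contract_map a b y = contract_map a b y'"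
    "contract_le A a b x' y'"
    unfolding contract_eq[OF po e] by auto
  then have "contract_le A a b x x'" "contract_le A a b y' y"
    using contract_le_antisym_iff[OF po e] xy by metis+
  then show "contract_le A a b x y" using *(5) contract_le_trans[OF po] by blast
next
  assume "contract_le A a b x y"
  then show "(contract_map a b x, contract_map a b y) \<in> contract A a b"
    using xy unfolding contract_eq[OF po e] by blast
qed

lemma Field_contract:
  assumes "Partial_order A" "edge A a b"
  shows "Field (contract A a b) = contract_map a b ` Field A"
proof -
  have "contract_le A a b x x" if "x \<in> Field A" for x
    using po_refl[OF assms(1) that] by (simp add: contract_le_def)
  then have "(contract_map a b x, contract_map a b x) \<in> contract A a b" if "x \<in> Field A" for x
    using contract_iff[OF assms] that by simp
  then have "contract_map a b ` Field A \<subseteq> Field (contract A a b)"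
    by (auto intro: FieldI1)
  moreover have "contract A a b \<subseteq> contract_map a b ` Field A \<times> contract_map a b ` Field A"
    unfolding contract_eq[OF assms] by blast
  then have "Field (contract A a b) \<subseteq> contract_map a b ` Field A"
    by (auto simp: Field_def)
  ultimately show ?thesis by blast
qed

text \<open>Such maps are the contraction of \<open>a\<close> and \<open>b\<close> followed by an
  isomorphism. The condition refers only to the orders of source and target, so a subtree of the
  source can serve as the contracted tree, and no poset of sets of vertices has to be handled.\<close>

definition collapses :: "'v rel \<Rightarrow> 'w rel \<Rightarrow> 'v \<Rightarrow> 'v \<Rightarrow> ('v \<Rightarrow> 'w) \<Rightarrow> bool" where
  "collapses A B a b f \<longleftrightarrow> f \<in> Field A \<rightarrow>\<^sub>E Field B \<and> f ` Field A = Field B \<and>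
     (\<forall>x \<in> Field A. \<forall>y \<in> Field A. (f x, f y) \<in> B \<longleftrightarrow> contract_le A a b x y)"

lemma collapses_eq_iff:
  assumes "Partial_order A" "Partial_order B" "edge A a b" "collapses A B a b f"
    and xy: "x \<in> Field A" "y \<in> Field A"
  shows "f x = f y \<longleftrightarrow> contract_map a b x = contract_map a b y"
proof -
  have "f x \<in> Field B" using assms(4) xy by (auto simp: collapses_def)
  then have "f x = f y \<longleftrightarrow> (f x, f y) \<in> B \<and> (f y, f x) \<in> B"
    using po_refl[OF assms(2)] po_antisym[OF assms(2)] by metis
  then show ?thesis
    using assms(4) contract_le_antisym_iff[OF assms(1,3) xy] xy unfolding collapses_def by simp
qed

lemma admissible_contraction_iff:
  assumes A: "Partial_order A" and B: "Partial_order B"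
  shows "admissible_contraction A B f \<longleftrightarrow> (\<exists>a b. admissible_edge A a b \<and> collapses A B a b f)"
proof
  assume "admissible_contraction A B f"
  then obtain a b \<alpha> where ab: "admissible_edge A a b" and \<alpha>: "poset_iso (contract A a b) B \<alpha>"
    and f: "f = compose (Field A) \<alpha> (contract_map a b)"
    unfolding admissible_contraction_def by blast
  have e: "edge A a b" using ab by (simp add: admissible_edge_def)
  have "collapses A B a b f"
    using \<alpha> contract_iff[OF A e]
    unfolding poset_iso_def embedding_def Field_contract[OF A e] collapses_def f
    by (auto simp: compose_def)
  then show "\<exists>a b. admissible_edge A a b \<and> collapses A B a b f" using ab by blast
next
  assume "\<exists>a b. admissible_edge A a b \<and> collapses A B a b f"
  then obtain a b where ab: "admissible_edge A a b" and c: "collapses A B a b f" by blast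
  have e: "edge A a b" using ab by (simp add: admissible_edge_def)
  let ?p = "contract_map a b"
  \<comment> \<open>The map f is constant on classes, so any representative serves to define it on the quotient.\<close>
  define \<alpha> where "\<alpha> = restrict (\<lambda>X. f (SOME x. x \<in> Field A \<and> ?p x = X)) (?p ` Field A)"
  have \<alpha>: "\<alpha> (?p x) = f x" if x: "x \<in> Field A" for x
  proof -
    let ?y = "SOME y. y \<in> Field A \<and> ?p y = ?p x"
    have "?y \<in> Field A \<and> ?p ?y = ?p x" by (rule someI[of _ x]) (use x in simp)
    then show ?thesis
      using collapses_eq_iff[OF A B e c, of ?y x] x by (simp add: \<alpha>_def)
  qed
  have fs: "f \<in> Field A \<rightarrow>\<^sub>E Field B" "f ` Field A = Field B"
    and f_iff: "\<And>x y. x \<in> Field A \<Longrightarrow> y \<in> Field A \<Longrightarrow> (f x, f y) \<in> B \<longleftrightarrow> contract_le A a b x y"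
    using c by (auto simp: collapses_def)
  have "\<alpha> \<in> ?p ` Field A \<rightarrow>\<^sub>E Field B"
  proof (rule PiE_I)
    show "\<alpha> X \<in> Field B" if "X \<in> ?p ` Field A" for X using that \<alpha> fs by auto
    show "\<alpha> X = undefined" if "X \<notin> ?p ` Field A" for X using that by (simp add: \<alpha>_def)
  qed
  moreover have "inj_on \<alpha> (?p ` Field A)"
    using \<alpha> collapses_eq_iff[OF A B e c] by (auto simp: inj_on_def)
  moreover have "\<alpha> ` (?p ` Field A) = Field B"
    using \<alpha> fs(2) by (force simp: image_image)
  moreover have "(X, Y) \<in> contract A a b \<longleftrightarrow> (\<alpha> X, \<alpha> Y) \<in> B"
    if "X \<in> ?p ` Field A" "Y \<in> ?p ` Field A" for X Y
    using that contract_iff[OF A e] f_iff \<alpha> by auto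
  ultimately have "poset_iso (contract A a b) B \<alpha>"
    unfolding poset_iso_def embedding_def Field_contract[OF A e] by blast
  moreover have "f = compose (Field A) \<alpha> ?p"
  proof
    show "f x = compose (Field A) \<alpha> ?p x" for x
      using fs(1) \<alpha>[of x] by (cases "x \<in> Field A") (auto simp: compose_def PiE_iff extensional_def)
  qed
  ultimately show "admissible_contraction A B f"
    using ab unfolding admissible_contraction_def by blast
qed


section \<open>Morphisms of trees and their images\<close>

lemma collapses_mono:
  assumes "collapses A B a b f"
  shows "f \<in> Field A \<rightarrow>\<^sub>E Field B" "(x, y) \<in> A \<Longrightarrow> (f x, f y) \<in> B"
  using assms by (auto simp: collapses_def contract_le_def intro: FieldI1 FieldI2)

lemma tree_contractionE:
  assumes "rooted_tree A" "rooted_tree B" "admissible_contraction A B f"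
  obtains a b where "admissible_edge A a b" "collapses A B a b f"
  using assms admissible_contraction_iff rooted_treeD(2) by metis

lemma tree_mor_mono:
  assumes "tree_mor A B f"
  shows "rooted_tree A \<and> rooted_tree B \<and> f \<in> Field A \<rightarrow>\<^sub>E Field B \<and>
    (\<forall>x y. (x, y) \<in> A \<longrightarrow> (f x, f y) \<in> B)"
  using assms
proof induction
  case (emb A B f)
  then show ?case unfolding embedding_def by (auto intro: FieldI1 FieldI2)
next
  case (contr A B f)
  then obtain a b where "collapses A B a b f" by (meson tree_contractionE)
  note f = collapses_mono[OF this]
  show ?case using contr f by simp
next
  case (comp A B f D g)
  then have "compose (Field A) g f \<in> Field A \<rightarrow>\<^sub>E Field D"
    by (auto simp: compose_def)
  moreover have "(compose (Field A) g f x, compose (Field A) g f y) \<in> D" if "(x, y) \<in> A" for x y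
    using comp that by (simp add: compose_def FieldI1[OF that] FieldI2[OF that])
  ultimately show ?case using comp by blast
qed

lemma tree_mor_minus_surj:
  assumes "tree_mor_minus A B f"
  shows "f ` Field A = Field B"
  using assms
proof induction
  case (iso A B f)
  then show ?case by (simp add: poset_iso_def)
next
  case (contr A B f)
  then show ?case by (metis tree_contractionE collapses_def)
next
  case (comp A B f D g)
  have "compose (Field A) g f ` Field A = g ` f ` Field A"
    by (auto simp: compose_def image_image intro!: image_cong)
  then show ?case using comp by simp
qed

lemma tree_mor_minus_imp_tree_mor: "tree_mor_minus A B f \<Longrightarrow> tree_mor A B f"
proof (induction rule: tree_mor_minus.induct)
  case (iso A B f)
  then show ?case by (simp add: poset_iso_def tree_mor.emb)
qed (rule tree_mor.contr tree_mor.comp; assumption)+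

text \<open>A set of vertices with a least element is a rooted tree in the induced order. Images of trees
  under monotone maps are of this kind.\<close>

definition rooted_subset :: "'v rel \<Rightarrow> 'v set \<Rightarrow> bool" where
  "rooted_subset B X \<longleftrightarrow> X \<subseteq> Field B \<and> (\<exists>r \<in> X. \<forall>x \<in> X. (r, x) \<in> B)"

lemma rooted_subset_tree:
  assumes "rooted_tree B" "rooted_subset B X"
  shows "rooted_tree (Restr B X)" "Field (Restr B X) = X"
  using assms rooted_tree_Restr[of B X] Field_Restr_tree[of B X]
  unfolding rooted_subset_def by blast+

lemma rooted_subset_Field: "rooted_tree A \<Longrightarrow> rooted_subset A (Field A)"
  by (meson rooted_tree_least rooted_subset_def subset_refl)

lemma rooted_subset_image:
  assumes "rooted_subset A X" "f \<in> Field A \<rightarrow>\<^sub>E Field B" "\<And>x y. (x, y) \<in> A \<Longrightarrow> (f x, f y) \<in> B"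
  shows "rooted_subset B (f ` X)"
proof -
  obtain r where r: "X \<subseteq> Field A" "r \<in> X" "\<forall>x \<in> X. (r, x) \<in> A"
    using assms(1) by (auto simp: rooted_subset_def)
  have "f ` X \<subseteq> Field B" using r(1) assms(2) by auto
  moreover have "\<forall>y \<in> f ` X. (f r, y) \<in> B" using r(3) assms(3) by simp
  ultimately show ?thesis using r(2) unfolding rooted_subset_def by blast
qed

lemma tree_mor_image:
  assumes "tree_mor A B f"
  shows "rooted_subset B (f ` Field A)"
  using tree_mor_mono[OF assms] rooted_subset_image[OF rooted_subset_Field, of A f B] by blast

lemma embedding_inclusion:
  assumes "rooted_tree B" "rooted_subset B X"
  shows "embedding (Restr B X) B (restrict id X)"
  using rooted_subset_tree[OF assms] assms(2)
  by (auto simp: embedding_def rooted_subset_def inj_on_def)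

text \<open>Since the vertices below \<open>b\<close> form a chain, \<open>a\<close> is comparable to each
  of them.\<close>

lemma below_edge:
  assumes A: "rooted_tree A" and e: "edge A a b" and x: "(x, b) \<in> A"
  shows "x = b \<or> (x, a) \<in> A"
proof -
  have "(x, a) \<in> A \<or> (a, x) \<in> A"
    using rooted_treeD(3)[OF A x, of a] e by (simp add: edge_def)
  moreover have "(a, a) \<in> A"
    using po_refl[OF rooted_treeD(2)[OF A]] edge_in_Field[OF e] by blast
  ultimately show ?thesis using e x by (auto simp: edge_def)
qed

lemma above_unique_successor:
  assumes A: "rooted_tree A" and succ: "\<And>c. edge A a c \<Longrightarrow> c = b" and y: "(a, y) \<in> A" "y \<noteq> a"
  shows "(b, y) \<in> A"
proof -
  note po = rooted_treeD(2)[OF A]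
  let ?X = "{c \<in> Field A. (a, c) \<in> A \<and> c \<noteq> a \<and> (c, y) \<in> A}"
  have "finite ?X" using rooted_treeD(1)[OF A] by simp
  moreover have "y \<in> ?X" using y FieldI2[OF y(1)] po_refl[OF po] by simp
  ultimately obtain m where m: "m \<in> ?X" "\<forall>c \<in> ?X. (c, m) \<in> A \<longrightarrow> c = m"
    using finite_minimal[OF po, of ?X] by blast
  have "c = a \<or> c = m" if "(a, c) \<in> A" "(c, m) \<in> A" for c
  proof -
    have "c \<in> Field A" "(c, y) \<in> A"
      using FieldI1[OF that(2)] po_trans[OF po that(2), of y] m(1) by auto
    then show ?thesis using m(2) that by auto
  qed
  then have "edge A a m" using m(1) by (auto simp: edge_def)
  then show ?thesis using succ m(1) by blast
qed

text \<open>This is where admissibility matters. If a rooted subset misses one end of the contracted edge,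
  the contraction creates no relation inside it. Without \<open>b\<close> this holds for any edge,
  as what lies strictly below \<open>b\<close> lies below \<open>a\<close>. Without
  \<open>a\<close> a new relation could only be of the form \<open>b \<le> y\<close> with
  \<open>a \<le> y\<close>; but if \<open>b\<close> is the only successor of \<open>a\<close>,
  then every \<open>y\<close> strictly above \<open>a\<close> is above \<open>b\<close> already,
  and if \<open>a\<close> is the root, then \<open>b\<close> is the least element of the subset.\<close>

lemma collapse_restrict_embedding:
  assumes B: "rooted_tree B" and ab: "admissible_edge B a b" and X: "rooted_subset B X"
    and not_both: "\<not> (a \<in> X \<and> b \<in> X)" and xy: "x \<in> X" "y \<in> X" and le: "contract_le B a b x y"
  shows "(x, y) \<in> B"
proof -
  note po = rooted_treeD(2)[OF B]
  have e: "edge B a b" using ab by (simp add: admissible_edge_def)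
  show ?thesis
  proof (cases "(x, y) \<in> B")
    case False
    then have xb: "(x, b) \<in> B" and ay: "(a, y) \<in> B" using le by (auto simp: contract_le_def)
    then have "(x, a) \<notin> B" using po_trans[OF po _ ay] False by blast
    then have [simp]: "x = b" using below_edge[OF B e xb] by blast
    then have "a \<notin> X" using not_both xy by blast
    show ?thesis
    proof (cases "is_root B a")
      case True
      obtain r where r: "r \<in> X" "\<And>x. x \<in> X \<Longrightarrow> (r, x) \<in> B"
        using X by (auto simp: rooted_subset_def)
      have "(r, a) \<notin> B" using True \<open>a \<notin> X\<close> r(1) by (auto simp: is_root_def)
      then have "r = b" using below_edge[OF B e, of r] r(2) xy by auto
      then show ?thesis using r(2) xy by simp
    next
      case False
      then have "\<And>c. edge B a c \<Longrightarrow> c = b" using ab by (auto simp: admissible_edge_def)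
      then show ?thesis
        using above_unique_successor[OF B _ ay] \<open>a \<notin> X\<close> xy by auto
    qed
  qed
qed

text \<open>If both ends of the edge lie in the subset, they form an admissible edge there and the
  restriction contracts it; otherwise the restriction is an isomorphism onto its image.\<close>

lemma collapses_restrict:
  assumes B: "rooted_tree B" and D: "rooted_tree D" and ab: "admissible_edge B a b"
    and f: "collapses B D a b f" and X: "rooted_subset B X"
  shows "tree_mor_minus (Restr B X) (Restr D (f ` X)) (restrict f X)"
proof -
  note po = rooted_treeD(2)[OF B]
  have fX: "rooted_subset D (f ` X)"
    using rooted_subset_image[OF X collapses_mono[OF f]] .
  note X' = rooted_subset_tree[OF B X] and fX' = rooted_subset_tree[OF D fX]
  have sub: "X \<subseteq> Field B" using X by (simp add: rooted_subset_def)
  have e: "edge B a b" using ab by (simp add: admissible_edge_def)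
  have f_iff: "(f x, f y) \<in> D \<longleftrightarrow> contract_le B a b x y" if "x \<in> X" "y \<in> X" for x y
    using f subsetD[OF sub that(1)] subsetD[OF sub that(2)] by (simp add: collapses_def)
  show ?thesis
  proof (cases "a \<in> X \<and> b \<in> X")
    case True
    have "edge (Restr B X) a b" using e True by (auto simp: edge_def)
    moreover have "is_root (Restr B X) a" if "is_root B a"
      using that True by (auto simp: is_root_def X'(2))
    moreover have "c = b" if succ: "\<And>c. edge B a c \<Longrightarrow> c = b" and c: "edge (Restr B X) a c" for c
    proof -
      have "(a, c) \<in> B" "c \<noteq> a" "c \<in> X" using c by (auto simp: edge_def)
      then have "(b, c) \<in> B" using above_unique_successor[OF B succ] by blast
      then show "c = b" using c True \<open>c \<in> X\<close> e by (auto simp: edge_def)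
    qed
    ultimately have "admissible_edge (Restr B X) a b"
      using ab unfolding admissible_edge_def by blast
    moreover have "collapses (Restr B X) (Restr D (f ` X)) a b (restrict f X)"
      unfolding collapses_def X'(2) fX'(2) using f_iff True
      by (auto simp: contract_le_def)
    ultimately have "admissible_contraction (Restr B X) (Restr D (f ` X)) (restrict f X)"
      using admissible_contraction_iff rooted_treeD(2)[OF X'(1)] rooted_treeD(2)[OF fX'(1)] by blast
    then show ?thesis using X'(1) fX'(1) by (blast intro: tree_mor_minus.contr)
  next
    case False
    have "contract_le B a b x y \<longleftrightarrow> (x, y) \<in> B" if "x \<in> X" "y \<in> X" for x y
      using collapse_restrict_embedding[OF B ab X False that] by (auto simp: contract_le_def)
    then have "embedding (Restr B X) (Restr D (f ` X)) (restrict f X)"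
      using f_iff by (intro embeddingI rooted_treeD(2)[OF X'(1)]) (auto simp: X'(2) fX'(2))
    then have "poset_iso (Restr B X) (Restr D (f ` X)) (restrict f X)"
      by (simp add: poset_iso_def X'(2) fX'(2))
    then show ?thesis using X'(1) fX'(1) by (blast intro: tree_mor_minus.iso)
  qed
qed

lemma tree_mor_minus_restrict:
  assumes "tree_mor_minus B D g" "rooted_subset B X"
  shows "tree_mor_minus (Restr B X) (Restr D (g ` X)) (restrict g X)"
  using assms
proof (induction arbitrary: X)
  case (iso A B f)
  then have f: "f \<in> Field A \<rightarrow>\<^sub>E Field B" "inj_on f (Field A)"
    "\<And>x y. x \<in> Field A \<Longrightarrow> y \<in> Field A \<Longrightarrow> (f x, f y) \<in> B \<longleftrightarrow> (x, y) \<in> A"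
    by (auto simp: poset_iso_def embedding_def)
  have X: "X \<subseteq> Field A" using iso by (simp add: rooted_subset_def)
  have fX: "rooted_subset B (f ` X)"
    by (rule rooted_subset_image[OF iso(4) f(1)]) (simp add: f(3) FieldI1 FieldI2)
  note X' = rooted_subset_tree[OF iso(1,4)] and fX' = rooted_subset_tree[OF iso(2) fX]
  have "embedding (Restr A X) (Restr B (f ` X)) (restrict f X)"
    using f(3) X by (intro embeddingI rooted_treeD(2)[OF X'(1)]) (auto simp: X'(2) fX'(2) subset_iff)
  then have "poset_iso (Restr A X) (Restr B (f ` X)) (restrict f X)"
    by (simp add: poset_iso_def X'(2) fX'(2))
  then show ?case using X'(1) fX'(1) by (blast intro: tree_mor_minus.iso)
next
  case (contr A B f)
  obtain a b where "admissible_edge A a b" "collapses A B a b f"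
    using contr(1-3) by (rule tree_contractionE)
  then show ?case by (rule collapses_restrict[OF contr(1,2) _ _ contr(4)])
next
  case (comp A B f D g)
  have f: "tree_mor A B f" using comp.hyps(1) by (rule tree_mor_minus_imp_tree_mor)
  have fX: "rooted_subset B (f ` X)"
    using rooted_subset_image[OF comp.prems] tree_mor_mono[OF f] by blast
  have X: "X \<subseteq> Field A" using comp.prems by (simp add: rooted_subset_def)
  have F: "Field (Restr A X) = X"
    using rooted_subset_tree(2)[OF _ comp.prems] tree_mor_mono[OF f] by blast
  have "tree_mor_minus (Restr A X) (Restr D (g ` f ` X))
      (compose (Field (Restr A X)) (restrict g (f ` X)) (restrict f X))"
    using comp.IH(1)[OF comp.prems] comp.IH(2)[OF fX] by (rule tree_mor_minus.comp)
  moreover have "compose (Field (Restr A X)) (restrict g (f ` X)) (restrict f X)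
      = restrict (compose (Field A) g f) X"
    using X by (auto simp: F compose_def restrict_def fun_eq_iff)
  moreover have "compose (Field A) g f ` X = g ` f ` X"
    using X by (auto simp: compose_def image_image subset_iff intro!: image_cong)
  ultimately show ?case by metis
qed

text \<open>Every morphism becomes a composite of isomorphisms and admissible contractions once its target
  is cut down to its image; together with the inclusion of the image this is the factorization
  required of a Reedy structure. In the inductive step, the contractions of the second factor are
  restricted to the image of the first, which is possible by
  \<open>tree_mor_minus_restrict\<close>.\<close>

theorem tree_mor_onto_image:
  assumes "tree_mor A B f"
  shows "tree_mor_minus A (Restr B (f ` Field A)) f"
  using assms
proof induction
  case (emb A B f)
  have "tree_mor A B f" using emb by (rule tree_mor.emb)
  note im = rooted_subset_tree[OF emb(2) tree_mor_image[OF this]]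
  have "poset_iso A (Restr B (f ` Field A)) f"
    using emb(3) by (auto simp: poset_iso_def embedding_def im(2))
  then show ?case using emb(1) im(1) by (blast intro: tree_mor_minus.iso)
next
  case (contr A B f)
  then have "f ` Field A = Field B" by (metis tree_contractionE collapses_def)
  then have "Restr B (f ` Field A) = B" by (simp add: Restr_Field)
  then show ?case using contr by (simp add: tree_mor_minus.contr)
next
  case (comp A B f D g)
  have fX: "rooted_subset B (f ` Field A)" using tree_mor_image[OF comp.hyps(1)] .
  have sub: "g ` f ` Field A \<subseteq> g ` Field B" using fX by (auto simp: rooted_subset_def)
  have "tree_mor_minus A (Restr (Restr D (g ` Field B)) (g ` f ` Field A))
      (compose (Field A) (restrict g (f ` Field A)) f)"
    using comp.IH(1) tree_mor_minus_restrict[OF comp.IH(2) fX] by (rule tree_mor_minus.comp)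
  moreover have "Restr (Restr D (g ` Field B)) (g ` f ` Field A) = Restr D (g ` f ` Field A)"
    using sub by auto
  moreover have "compose (Field A) (restrict g (f ` Field A)) f = compose (Field A) g f"
    by (auto simp: compose_def restrict_def fun_eq_iff)
  moreover have "compose (Field A) g f ` Field A = g ` f ` Field A"
    by (auto simp: compose_def image_image intro!: image_cong)
  ultimately show ?case by metis
qed

lemma edge_iso_iff:
  assumes f: "poset_iso A B f" and xy: "x \<in> Field A" "y \<in> Field A"
  shows "edge B (f x) (f y) \<longleftrightarrow> edge A x y"
proof -
  have im: "f ` Field A = Field B" and inj: "inj_on f (Field A)"
    and iff: "\<And>x y. x \<in> Field A \<Longrightarrow> y \<in> Field A \<Longrightarrow> (f x, f y) \<in> B \<longleftrightarrow> (x, y) \<in> A"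
    using f by (auto simp: poset_iso_def embedding_def)
  have "(\<forall>c. (f x, c) \<in> B \<and> (c, f y) \<in> B \<longrightarrow> c = f x \<or> c = f y) \<longleftrightarrow>
      (\<forall>c \<in> Field B. (f x, c) \<in> B \<and> (c, f y) \<in> B \<longrightarrow> c = f x \<or> c = f y)"
    by (auto intro: FieldI1)
  also have "\<dots> \<longleftrightarrow> (\<forall>c \<in> Field A. (x, c) \<in> A \<and> (c, y) \<in> A \<longrightarrow> c = x \<or> c = y)"
    unfolding im[symmetric] using iff xy inj_on_eq_iff[OF inj] by simp
  also have "\<dots> \<longleftrightarrow> (\<forall>c. (x, c) \<in> A \<and> (c, y) \<in> A \<longrightarrow> c = x \<or> c = y)"
    by (auto intro: FieldI1)
  finally show ?thesis using iff xy inj_on_eq_iff[OF inj] by (simp add: edge_def)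
qed

lemma admissible_edge_pullback:
  assumes f: "poset_iso A B f" and ab: "a \<in> Field A" "b \<in> Field A"
    and adm: "admissible_edge B (f a) (f b)"
  shows "admissible_edge A a b"
proof -
  have im: "f ` Field A = Field B" and inj: "inj_on f (Field A)"
    and iff: "\<And>x y. x \<in> Field A \<Longrightarrow> y \<in> Field A \<Longrightarrow> (f x, f y) \<in> B \<longleftrightarrow> (x, y) \<in> A"
    using f by (auto simp: poset_iso_def embedding_def)
  have "edge A a b" using edge_iso_iff[OF f ab] adm by (simp add: admissible_edge_def)
  moreover have "is_root A a" if root: "is_root B (f a)"
  proof -
    have "y = a" if y: "(y, a) \<in> A" for y
      using root iff[of y a] ab FieldI1[OF y] y inj_on_eq_iff[OF inj, of y a] by (auto simp: is_root_def)
    then show ?thesis using ab by (simp add: is_root_def)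
  qed
  moreover have "c = b" if succ: "\<forall>c. edge B (f a) c \<longrightarrow> c = f b" and c: "edge A a c" for c
    using succ c edge_iso_iff[OF f ab(1), of c] edge_in_Field[OF c] inj_on_eq_iff[OF inj, of c b] ab
    by blast
  ultimately show ?thesis using adm unfolding admissible_edge_def by blast
qed

text \<open>The first factor of a composite that is not an isomorphism contracts an admissible edge, and the
  isomorphisms before it carry this edge back to the source. Hence a non-invertible composite of
  isomorphisms and admissible contractions is unchanged when it is preceded by the retraction
  along some admissible edge.\<close>

lemma tree_mor_minus_iso_or_collapse:
  assumes "tree_mor_minus A B f"
  shows "poset_iso A B f \<or> (\<exists>a b. admissible_edge A a b \<and> f a = f b)"
  using assms
proof induction
  case (iso A B f)
  then show ?case by blast
next
  case (contr A B f)
  then obtain a b where ab: "admissible_edge A a b" and f: "collapses A B a b f"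
    by (meson tree_contractionE)
  have e: "edge A a b" using ab by (simp add: admissible_edge_def)
  have "f a = f b"
    using collapses_eq_iff[OF rooted_treeD(2)[OF contr(1)] rooted_treeD(2)[OF contr(2)] e f]
      edge_in_Field[OF e] by (simp add: contract_map_def)
  then show ?case using ab by blast
next
  case (comp A B f D g)
  have eq: "compose (Field A) g f a = compose (Field A) g f b"
    if "admissible_edge A a b" "g (f a) = g (f b)" for a b
  proof -
    have "a \<in> Field A" "b \<in> Field A" using that(1) edge_in_Field[of A a b] by (auto simp: admissible_edge_def)
    then show ?thesis using that(2) by (simp add: compose_def)
  qed
  show ?case
  proof (cases "poset_iso A B f")
    case False
    then show ?thesis using comp.IH(1) eq by metis
  next
    case True
    show ?thesis
    proof (cases "poset_iso B D g")
      case True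
      then show ?thesis using poset_iso_compose \<open>poset_iso A B f\<close> by blast
    next
      case False
      then obtain a' b' where ab': "admissible_edge B a' b'" and g: "g a' = g b'"
        using comp.IH(2) by blast
      have e': "edge B a' b'" using ab' by (simp add: admissible_edge_def)
      have im: "f ` Field A = Field B" using True by (simp add: poset_iso_def)
      obtain a b where a: "a \<in> Field A" "f a = a'" and b: "b \<in> Field A" "f b = b'"
        using edge_in_Field[OF e'] im by (metis imageE)
      have "admissible_edge A a b" using admissible_edge_pullback[OF True] a b ab' by simp
      then show ?thesis using eq a b g by blast
    qed
  qed
qed

lemma tree_mor_minus_card:
  assumes "tree_mor_minus A B f"
  shows "poset_iso A B f \<or> card (Field B) < card (Field A)"
proof (cases "poset_iso A B f")
  case False
  then obtain a b where ab: "admissible_edge A a b" "f a = f b"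
    using tree_mor_minus_iso_or_collapse[OF assms] by blast
  then have "a \<in> Field A" "b \<in> Field A" "a \<noteq> b"
    using edge_in_Field[of A a b] by (auto simp: admissible_edge_def edge_def)
  then have "\<not> inj_on f (Field A)" using ab(2) by (auto dest: inj_onD)
  moreover have "finite (Field A)"
    using tree_mor_mono[OF tree_mor_minus_imp_tree_mor[OF assms]] rooted_treeD(1) by blast
  ultimately have "card (f ` Field A) \<noteq> card (Field A)" "card (f ` Field A) \<le> card (Field A)"
    using eq_card_imp_inj_on card_image_le by blast+
  then show ?thesis using tree_mor_minus_surj[OF assms] by simp
qed simp


section \<open>Retractions along admissible edges\<close>

text \<open>The contraction of the edge, made an endomorphism by placing the contracted tree inside
  \<open>A\<close> as the complement of \<open>b\<close>.\<close>

definition retraction :: "'v rel \<Rightarrow> 'v \<times> 'v \<Rightarrow> 'v \<Rightarrow> 'v" where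
  "retraction A = (\<lambda>(a, b). restrict (id(b := a)) (Field A))"

text \<open>The complement of \<open>b\<close> is a copy of the contracted tree: replacing \<open>b\<close>
  by \<open>a\<close> on either side of a relation has the same effect as allowing a passage from
  \<open>b\<close> to \<open>a\<close>, because everything strictly below \<open>b\<close> is
  below \<open>a\<close>.\<close>

lemma retraction_collapses:
  assumes A: "rooted_tree A" and e: "edge A a b"
  shows "rooted_subset A (Field A - {b})"
    and "collapses A (Restr A (Field A - {b})) a b (retraction A (a, b))"
proof -
  note po = rooted_treeD(2)[OF A]
  have ab: "(a, b) \<in> A" "a \<noteq> b" "a \<in> Field A" "b \<in> Field A"
    using e edge_in_Field[OF e] by (auto simp: edge_def)
  obtain r where r: "r \<in> Field A" "\<And>x. x \<in> Field A \<Longrightarrow> (r, x) \<in> A"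
    using rooted_tree_least[OF A] by blast
  have "r \<noteq> b" using ab r(2) po_antisym[OF po] by blast
  then show sub: "rooted_subset A (Field A - {b})"
    using r by (auto simp: rooted_subset_def)
  note F = rooted_subset_tree[OF A sub]
  have below: "(x, b) \<in> A \<longleftrightarrow> (x, a) \<in> A" if "x \<noteq> b" for x
    using below_edge[OF A e] that po_trans[OF po _ ab(1)] by blast
  have above: "(b, y) \<in> A \<Longrightarrow> (a, y) \<in> A" for y
    using po_trans[OF po ab(1)] .
  have loops: "(a, a) \<in> A" "(b, b) \<in> A" using po_refl[OF po] ab by auto
  have iff: "((id(b := a)) x, (id(b := a)) y) \<in> A \<longleftrightarrow> contract_le A a b x y" for x y
  proof -
    consider "x = b" "y = b" | "x = b" "y \<noteq> b" | "x \<noteq> b" "y = b" | "x \<noteq> b" "y \<noteq> b" by blast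
    then show ?thesis
    proof cases
      case 1 then show ?thesis using loops by (simp add: contract_le_def)
    next
      case 2 then show ?thesis using loops above[of y] ab(2) by (auto simp: contract_le_def)
    next
      case 3 then show ?thesis using below[of x] ab(1) by (simp add: contract_le_def)
    next
      case 4
      have "(x, b) \<in> A \<Longrightarrow> (a, y) \<in> A \<Longrightarrow> (x, y) \<in> A"
        using below[OF 4(1)] po_trans[OF po, of x a y] by blast
      then show ?thesis using 4 by (auto simp: contract_le_def)
    qed
  qed
  show "collapses A (Restr A (Field A - {b})) a b (retraction A (a, b))"
    unfolding collapses_def F(2) using iff ab
    by (auto simp: retraction_def image_iff)
qed

lemma retraction_minus:
  assumes A: "rooted_tree A" and ab: "admissible_edge A a b"
  shows "tree_mor_minus A (Restr A (Field A - {b})) (retraction A (a, b))"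
proof -
  have e: "edge A a b" using ab by (simp add: admissible_edge_def)
  note c = retraction_collapses[OF A e] and T = rooted_subset_tree(1)[OF A retraction_collapses(1)[OF A e]]
  have "admissible_contraction A (Restr A (Field A - {b})) (retraction A (a, b))"
    using admissible_contraction_iff[OF rooted_treeD(2)[OF A] rooted_treeD(2)[OF T]] ab c(2) by blast
  then show ?thesis using A T by (blast intro: tree_mor_minus.contr)
qed

lemma compose_retraction:
  assumes "admissible_edge A a b" "f a = f b" "f \<in> extensional (Field A)"
  shows "compose (Field A) f (retraction A (a, b)) = f"
proof
  show "compose (Field A) f (retraction A (a, b)) x = f x" for x
    using assms by (cases "x \<in> Field A") (auto simp: compose_def retraction_def extensional_def)
qed

lemma retraction_idem:
  assumes "admissible_edge A a b"
  shows "compose (Field A) (retraction A (a, b)) (retraction A (a, b)) = retraction A (a, b)"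
  by (rule compose_retraction[OF assms])
    (use assms edge_in_Field[of A a b] in \<open>auto simp: retraction_def admissible_edge_def edge_def\<close>)

text \<open>Two retractions can fail to commute only if one edge starts where the other ends. If the second
  edge \<open>(a', b')\<close> does not start at \<open>b\<close>, the map
  \<open>p' \<circ> p\<close> already identifies \<open>a'\<close> and \<open>b'\<close>, so
  composing it further with \<open>p'\<close> on the right changes nothing. The hypothesis on
  \<open>b\<close> and \<open>b'\<close> excludes the bad case. On a chain this is the relation
  \<open>p\<^sub>1 p\<^sub>2 p\<^sub>1 = p\<^sub>1 p\<^sub>2\<close>, but
  \<open>p\<^sub>2 p\<^sub>1 p\<^sub>2\<close> differs from \<open>p\<^sub>2 p\<^sub>1\<close>.\<close>

lemma retraction_braid:
  assumes A: "rooted_tree A" and e: "admissible_edge A a b" and e': "admissible_edge A a' b'"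
    and neq: "(a', b') \<noteq> (a, b)" and max: "(b, b') \<in> A \<Longrightarrow> b' = b"
  shows "compose (Field A) (compose (Field A) (retraction A (a', b')) (retraction A (a, b)))
      (retraction A (a', b')) = compose (Field A) (retraction A (a', b')) (retraction A (a, b))"
proof -
  note po = rooted_treeD(2)[OF A]
  have E: "edge A a b" "edge A a' b'" using e e' by (auto simp: admissible_edge_def)
  have F: "a \<in> Field A" "b \<in> Field A" "a' \<in> Field A" "b' \<in> Field A"
    using edge_in_Field[OF E(1)] edge_in_Field[OF E(2)] by auto
  have ne: "a \<noteq> b" "a' \<noteq> b'" and le: "(a, b) \<in> A" "(a', b') \<in> A" using E by (auto simp: edge_def)
  \<comment> \<open>A vertex covers at most one vertex, so distinct edges have distinct upper ends.\<close>
  have "b' \<noteq> b"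
  proof
    assume [simp]: "b' = b"
    have "(a', a) \<in> A" "(a, a') \<in> A"
      using below_edge[OF A E(1), of a'] below_edge[OF A E(2), of a] ne le by auto
    then show False using po_antisym[OF po] neq by auto
  qed
  moreover have "a' \<noteq> b" using max le(2) \<open>b' \<noteq> b\<close> by blast
  ultimately show ?thesis
    by (intro compose_retraction[OF e']) (use F ne in \<open>auto simp: compose_def retraction_def\<close>)
qed


section \<open>Linear maps and free modules\<close>

lemma mod_homD:
  assumes "f \<in> mod_hom R M N"
  shows "x \<in> carrier M \<Longrightarrow> f x \<in> carrier N"
    and "x \<in> carrier M \<Longrightarrow> y \<in> carrier M \<Longrightarrow> f (x \<oplus>\<^bsub>M\<^esub> y) = f x \<oplus>\<^bsub>N\<^esub> f y"
    and "r \<in> carrier R \<Longrightarrow> x \<in> carrier M \<Longrightarrow> f (r \<odot>\<^bsub>M\<^esub> x) = r \<odot>\<^bsub>N\<^esub> f x"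
  using assms by (auto simp: mod_hom_def)

lemma mod_homI:
  assumes "\<And>x. x \<in> carrier M \<Longrightarrow> f x \<in> carrier N"
    and "\<And>x y. x \<in> carrier M \<Longrightarrow> y \<in> carrier M \<Longrightarrow> f (x \<oplus>\<^bsub>M\<^esub> y) = f x \<oplus>\<^bsub>N\<^esub> f y"
    and "\<And>r x. r \<in> carrier R \<Longrightarrow> x \<in> carrier M \<Longrightarrow> f (r \<odot>\<^bsub>M\<^esub> x) = r \<odot>\<^bsub>N\<^esub> f x"
  shows "f \<in> mod_hom R M N"
  using assms by (auto simp: mod_hom_def)

lemma mod_hom_group_hom:
  assumes "module R M" "module R N" "f \<in> mod_hom R M N"
  shows "abelian_group_hom M N f"
proof -
  have M: "abelian_group M" and N: "abelian_group N"
    using assms(1,2) by (auto simp: module_def)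
  have "f \<in> hom (add_monoid M) (add_monoid N)"
    using mod_homD[OF assms(3)] by (auto simp: hom_def)
  then have "group_hom (add_monoid M) (add_monoid N) f"
    using M N by (simp add: group_hom_def group_hom_axioms_def abelian_group.a_group)
  then show ?thesis using M N by (intro abelian_group_homI)
qed

lemma mod_hom_cong:
  assumes "module R M" "f \<in> mod_hom R M N" "\<And>x. x \<in> carrier M \<Longrightarrow> g x = f x"
  shows "g \<in> mod_hom R M N"
proof -
  interpret module R M by fact
  show ?thesis by (rule mod_homI) (use mod_homD[OF assms(2)] assms(3) in auto)
qed

lemma mod_hom_compose:
  assumes "f \<in> mod_hom R M N" "g \<in> mod_hom R N L"
  shows "(\<lambda>x. g (f x)) \<in> mod_hom R M L"
  by (rule mod_homI) (use mod_homD[OF assms(1)] mod_homD[OF assms(2)] in auto)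

lemma mod_hom_id: "(\<lambda>x. x) \<in> mod_hom R M M"
  by (rule mod_homI) auto

lemma free_module_carrier:
  "u \<in> carrier (free_module R B) \<longleftrightarrow>
    (\<forall>b. u b \<in> carrier R) \<and> {b. u b \<noteq> \<zero>\<^bsub>R\<^esub>} \<subseteq> B \<and> finite {b. u b \<noteq> \<zero>\<^bsub>R\<^esub>}"
  by (auto simp: free_module_def)

lemma free_module_ops [simp]:
  "\<zero>\<^bsub>free_module R B\<^esub> = (\<lambda>b. \<zero>\<^bsub>R\<^esub>)"
  "u \<oplus>\<^bsub>free_module R B\<^esub> v = (\<lambda>b. u b \<oplus>\<^bsub>R\<^esub> v b)"
  "r \<odot>\<^bsub>free_module R B\<^esub> u = (\<lambda>b. r \<otimes>\<^bsub>R\<^esub> u b)"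
  by (simp_all add: free_module_def)

lemma free_module_module:
  assumes "cring R"
  shows "module R (free_module R B)"
proof -
  interpret R: cring R by fact
  have add: "(\<lambda>b. u b \<oplus>\<^bsub>R\<^esub> v b) \<in> carrier (free_module R B)"
    if u: "u \<in> carrier (free_module R B)" and v: "v \<in> carrier (free_module R B)" for u v
  proof -
    have "{b. u b \<oplus>\<^bsub>R\<^esub> v b \<noteq> \<zero>\<^bsub>R\<^esub>} \<subseteq> {b. u b \<noteq> \<zero>\<^bsub>R\<^esub>} \<union> {b. v b \<noteq> \<zero>\<^bsub>R\<^esub>}" by auto
    then show ?thesis
      using u v unfolding free_module_carrier by (auto intro: finite_subset)
  qed
  have smult: "(\<lambda>b. r \<otimes>\<^bsub>R\<^esub> u b) \<in> carrier (free_module R B)"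
    if r: "r \<in> carrier R" and u: "u \<in> carrier (free_module R B)" for r u
  proof -
    have "{b. r \<otimes>\<^bsub>R\<^esub> u b \<noteq> \<zero>\<^bsub>R\<^esub>} \<subseteq> {b. u b \<noteq> \<zero>\<^bsub>R\<^esub>}" using r by auto
    then show ?thesis
      using r u unfolding free_module_carrier by (auto intro: finite_subset)
  qed
  have neg: "(\<lambda>b. \<ominus>\<^bsub>R\<^esub> u b) \<in> carrier (free_module R B)" if u: "u \<in> carrier (free_module R B)" for u
  proof -
    have "{b. \<ominus>\<^bsub>R\<^esub> u b \<noteq> \<zero>\<^bsub>R\<^esub>} \<subseteq> {b. u b \<noteq> \<zero>\<^bsub>R\<^esub>}" by auto
    then show ?thesis
      using u unfolding free_module_carrier by (auto intro: finite_subset)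
  qed
  have coeff: "u b \<in> carrier R" if "u \<in> carrier (free_module R B)" for u b
    using that by (simp add: free_module_carrier)
  have "abelian_group (free_module R B)"
  proof (rule abelian_groupI)
    show "\<exists>v \<in> carrier (free_module R B). v \<oplus>\<^bsub>free_module R B\<^esub> u = \<zero>\<^bsub>free_module R B\<^esub>"
      if "u \<in> carrier (free_module R B)" for u
      using neg[OF that] coeff[OF that] by (intro bexI[of _ "\<lambda>b. \<ominus>\<^bsub>R\<^esub> u b"]) (auto simp: R.l_neg)
  qed (auto simp: add coeff R.a_ac, auto simp: free_module_carrier)
  then show ?thesis
    by (intro moduleI assms)
      (auto simp: smult coeff R.l_distr R.r_distr R.m_assoc)
qed

lemma basis_elem_carrier:
  assumes "cring R" "f \<in> B"
  shows "basis_elem R f \<in> carrier (free_module R B)"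
proof -
  interpret cring R by fact
  have "{b. basis_elem R f b \<noteq> \<zero>\<^bsub>R\<^esub>} \<subseteq> {f}" by (auto simp: basis_elem_def)
  then show ?thesis using assms(2) finite_subset unfolding free_module_carrier
    by (auto simp: basis_elem_def)
qed

definition linear_extension :: "('k, 'r) ring_scheme \<Rightarrow> ('k, 'm) module \<Rightarrow> ('a \<Rightarrow> 'm) \<Rightarrow> ('a \<Rightarrow> 'k) \<Rightarrow> 'm" where
  "linear_extension R M b u = (\<Oplus>\<^bsub>M\<^esub>f \<in> {f. u f \<noteq> \<zero>\<^bsub>R\<^esub>}. u f \<odot>\<^bsub>M\<^esub> b f)"

lemma linear_extension_superset:
  assumes "module R M" "b \<in> B \<rightarrow> carrier M" "u \<in> carrier (free_module R B)"
    and F: "finite F" "{f. u f \<noteq> \<zero>\<^bsub>R\<^esub>} \<subseteq> F" "F \<subseteq> B"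
  shows "linear_extension R M b u = (\<Oplus>\<^bsub>M\<^esub>f \<in> F. u f \<odot>\<^bsub>M\<^esub> b f)"
proof -
  interpret module R M by fact
  have u: "u f \<in> carrier R" for f using assms(3) by (simp add: free_module_carrier)
  have b: "b f \<in> carrier M" if "f \<in> F" for f using that assms(2) F(3) by auto
  show ?thesis unfolding linear_extension_def
    by (rule M.add.finprod_mono_neutral_cong_left) (use F u b in auto)
qed

lemma linear_extension_hom:
  assumes M: "module R M" and b: "b \<in> B \<rightarrow> carrier M"
  shows "linear_extension R M b \<in> mod_hom R (free_module R B) M"
proof -
  interpret module R M by fact
  interpret F: module R "free_module R B" by (rule free_module_module) (rule R.is_cring)
  note linear_extension = linear_extension_superset[OF M b]
  have coeff: "u f \<in> carrier R" if "u \<in> carrier (free_module R B)" for u f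
    using that by (simp add: free_module_carrier)
  have supp: "finite {f. u f \<noteq> \<zero>\<^bsub>R\<^esub>}" "{f. u f \<noteq> \<zero>\<^bsub>R\<^esub>} \<subseteq> B" if "u \<in> carrier (free_module R B)" for u
    using that by (simp_all add: free_module_carrier)
  have bc: "b f \<in> carrier M" if "f \<in> B" for f using that b by auto
  show ?thesis
  proof (rule mod_homI)
    fix u assume u: "u \<in> carrier (free_module R B)"
    show "linear_extension R M b u \<in> carrier M"
      unfolding linear_extension_def by (rule M.finsum_closed) (use coeff[OF u] supp[OF u] bc in auto)
    fix v assume v: "v \<in> carrier (free_module R B)"
    let ?F = "{f. u f \<noteq> \<zero>\<^bsub>R\<^esub>} \<union> {f. v f \<noteq> \<zero>\<^bsub>R\<^esub>}"
    have F: "finite ?F" "?F \<subseteq> B" using supp[OF u] supp[OF v] by auto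
    have cl: "(\<lambda>f. u f \<odot>\<^bsub>M\<^esub> b f) \<in> ?F \<rightarrow> carrier M" "(\<lambda>f. v f \<odot>\<^bsub>M\<^esub> b f) \<in> ?F \<rightarrow> carrier M"
      using coeff[OF u] coeff[OF v] bc F(2) by auto
    have "linear_extension R M b (u \<oplus>\<^bsub>free_module R B\<^esub> v) = (\<Oplus>\<^bsub>M\<^esub>f \<in> ?F. (u \<oplus>\<^bsub>free_module R B\<^esub> v) f \<odot>\<^bsub>M\<^esub> b f)"
      by (rule linear_extension[OF F.M.a_closed[OF u v] F(1) _ F(2)]) auto
    also have "\<dots> = (\<Oplus>\<^bsub>M\<^esub>f \<in> ?F. u f \<odot>\<^bsub>M\<^esub> b f \<oplus>\<^bsub>M\<^esub> v f \<odot>\<^bsub>M\<^esub> b f)"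
    proof (rule M.finsum_cong'[OF refl])
      show "(\<lambda>f. u f \<odot>\<^bsub>M\<^esub> b f \<oplus>\<^bsub>M\<^esub> v f \<odot>\<^bsub>M\<^esub> b f) \<in> ?F \<rightarrow> carrier M" using cl by auto
      show "(u \<oplus>\<^bsub>free_module R B\<^esub> v) f \<odot>\<^bsub>M\<^esub> b f = u f \<odot>\<^bsub>M\<^esub> b f \<oplus>\<^bsub>M\<^esub> v f \<odot>\<^bsub>M\<^esub> b f"
        if "f \<in> ?F" for f
        using subsetD[OF F(2) that] bc coeff[OF u] coeff[OF v] by (simp add: smult_l_distr)
    qed
    also have "\<dots> = (\<Oplus>\<^bsub>M\<^esub>f \<in> ?F. u f \<odot>\<^bsub>M\<^esub> b f) \<oplus>\<^bsub>M\<^esub> (\<Oplus>\<^bsub>M\<^esub>f \<in> ?F. v f \<odot>\<^bsub>M\<^esub> b f)"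
      using cl by (rule M.finsum_addf)
    also have "\<dots> = linear_extension R M b u \<oplus>\<^bsub>M\<^esub> linear_extension R M b v"
      using linear_extension[OF u F(1) _ F(2)] linear_extension[OF v F(1) _ F(2)] by simp
    finally show "linear_extension R M b (u \<oplus>\<^bsub>free_module R B\<^esub> v) = linear_extension R M b u \<oplus>\<^bsub>M\<^esub> linear_extension R M b v" .
  next
    fix r u assume r: "r \<in> carrier R" and u: "u \<in> carrier (free_module R B)"
    let ?F = "{f. u f \<noteq> \<zero>\<^bsub>R\<^esub>}"
    note F = supp[OF u]
    have "linear_extension R M b (r \<odot>\<^bsub>free_module R B\<^esub> u) = (\<Oplus>\<^bsub>M\<^esub>f \<in> ?F. (r \<odot>\<^bsub>free_module R B\<^esub> u) f \<odot>\<^bsub>M\<^esub> b f)"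
      by (rule linear_extension[OF F.smult_closed[OF r u] F(1) _ F(2)]) (use r in auto)
    also have "\<dots> = (\<Oplus>\<^bsub>M\<^esub>f \<in> ?F. r \<odot>\<^bsub>M\<^esub> (u f \<odot>\<^bsub>M\<^esub> b f))"
    proof (rule M.finsum_cong'[OF refl])
      show "(\<lambda>f. r \<odot>\<^bsub>M\<^esub> (u f \<odot>\<^bsub>M\<^esub> b f)) \<in> ?F \<rightarrow> carrier M"
        using r coeff[OF u] bc F(2) by auto
      show "(r \<odot>\<^bsub>free_module R B\<^esub> u) f \<odot>\<^bsub>M\<^esub> b f = r \<odot>\<^bsub>M\<^esub> (u f \<odot>\<^bsub>M\<^esub> b f)" if "f \<in> ?F" for f
        using subsetD[OF F(2) that] bc coeff[OF u] r by (simp add: smult_assoc1)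
    qed
    also have "\<dots> = r \<odot>\<^bsub>M\<^esub> linear_extension R M b u"
      unfolding linear_extension_def using coeff[OF u] bc F r by (intro finsum_smult_ldistr[symmetric]) auto
    finally show "linear_extension R M b (r \<odot>\<^bsub>free_module R B\<^esub> u) = r \<odot>\<^bsub>M\<^esub> linear_extension R M b u" .
  qed
qed

lemma linear_extension_basis:
  assumes M: "module R M" and b: "b \<in> B \<rightarrow> carrier M" and f: "f \<in> B"
  shows "linear_extension R M b (basis_elem R f) = b f"
proof -
  interpret module R M by fact
  have bf: "b f \<in> carrier M" using b f by auto
  have "linear_extension R M b (basis_elem R f) = (\<Oplus>\<^bsub>M\<^esub>g \<in> {f}. basis_elem R f g \<odot>\<^bsub>M\<^esub> b g)"
    by (rule linear_extension_superset[OF M b basis_elem_carrier[OF R.is_cring f]])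
      (use f in \<open>auto simp: basis_elem_def\<close>)
  also have "\<dots> = b f"
    using bf by (simp add: basis_elem_def)
  finally show ?thesis .
qed

lemma free_hom_eqI:
  assumes "cring R" "module R M"
    and \<phi>: "\<phi> \<in> mod_hom R (free_module R B) M" and \<psi>: "\<psi> \<in> mod_hom R (free_module R B) M"
    and basis: "\<And>f. f \<in> B \<Longrightarrow> \<phi> (basis_elem R f) = \<psi> (basis_elem R f)"
    and u: "u \<in> carrier (free_module R B)"
  shows "\<phi> u = \<psi> u"
proof -
  interpret R: cring R by fact
  note FM = free_module_module[OF \<open>cring R\<close>, of B]
  have "finite {f. u f \<noteq> \<zero>\<^bsub>R\<^esub>}" using u by (simp add: free_module_carrier)
  then show ?thesis
    using u
  proof (induction "{f. u f \<noteq> \<zero>\<^bsub>R\<^esub>}" arbitrary: u rule: finite_induct)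
    case empty
    then have "u = \<zero>\<^bsub>free_module R B\<^esub>" by auto
    then show ?case
      using abelian_group_hom.hom_zero[OF mod_hom_group_hom[OF FM assms(2) \<phi>]]
        abelian_group_hom.hom_zero[OF mod_hom_group_hom[OF FM assms(2) \<psi>]] by simp
  next
    case (insert f F)
    have f: "f \<in> B" "u f \<in> carrier R" using insert.hyps(4) insert.prems by (auto simp: free_module_carrier)
    let ?v = "u(f := \<zero>\<^bsub>R\<^esub>)"
    have supp: "{g. ?v g \<noteq> \<zero>\<^bsub>R\<^esub>} = F"
    proof -
      have "{g. ?v g \<noteq> \<zero>\<^bsub>R\<^esub>} = {g. u g \<noteq> \<zero>\<^bsub>R\<^esub>} - {f}" by auto
      then show ?thesis using insert.hyps by auto
    qed
    have v: "?v \<in> carrier (free_module R B)"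
      using insert.prems insert.hyps(1,4) supp unfolding free_module_carrier by auto
    have e: "u f \<odot>\<^bsub>free_module R B\<^esub> basis_elem R f \<in> carrier (free_module R B)"
      by (rule module.smult_closed[OF FM f(2) basis_elem_carrier[OF \<open>cring R\<close> f(1)]])
    have dec: "u = (u f \<odot>\<^bsub>free_module R B\<^esub> basis_elem R f) \<oplus>\<^bsub>free_module R B\<^esub> ?v"
    proof
      fix g
      have "u g \<in> carrier R" using insert.prems by (simp add: free_module_carrier)
      then show "u g = ((u f \<odot>\<^bsub>free_module R B\<^esub> basis_elem R f) \<oplus>\<^bsub>free_module R B\<^esub> ?v) g"
        using f by (simp add: basis_elem_def)
    qed
    have hom: "\<chi> u = (u f \<odot>\<^bsub>M\<^esub> \<chi> (basis_elem R f)) \<oplus>\<^bsub>M\<^esub> \<chi> ?v"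
      if \<chi>: "\<chi> \<in> mod_hom R (free_module R B) M" for \<chi>
      using mod_homD(2)[OF \<chi> e v] mod_homD(3)[OF \<chi> f(2) basis_elem_carrier[OF \<open>cring R\<close> f(1)]] dec
      by metis
    show ?case
      using hom[OF \<phi>] hom[OF \<psi>] basis[OF f(1)] insert.hyps(3)[OF supp[symmetric] v] by simp
  qed
qed


section \<open>Representable modules\<close>

lemma nat_transD:
  assumes "\<phi> \<in> nat_trans C R M N"
  shows "x \<in> Obj C \<Longrightarrow> \<phi> x \<in> mod_hom R (val M x) (val N x)"
    and "x \<in> Obj C \<Longrightarrow> y \<in> Obj C \<Longrightarrow> f \<in> Hom C x y \<Longrightarrow> u \<in> carrier (val M x) \<Longrightarrow>
      \<phi> y (act M x y f u) = act N x y f (\<phi> x u)"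
  using assms by (auto simp: nat_trans_def)

lemma nat_trans_closed:
  "\<phi> \<in> nat_trans C R M N \<Longrightarrow> x \<in> Obj C \<Longrightarrow> u \<in> carrier (val M x) \<Longrightarrow> \<phi> x u \<in> carrier (val N x)"
  using nat_transD(1) mod_homD(1) by metis

lemma nat_transI:
  assumes "\<And>x. x \<in> Obj C \<Longrightarrow> \<phi> x \<in> mod_hom R (val M x) (val N x)"
    and "\<And>x y f u. x \<in> Obj C \<Longrightarrow> y \<in> Obj C \<Longrightarrow> f \<in> Hom C x y \<Longrightarrow> u \<in> carrier (val M x) \<Longrightarrow>
      \<phi> y (act M x y f u) = act N x y f (\<phi> x u)"
  shows "\<phi> \<in> nat_trans C R M N"
  using assms by (auto simp: nat_trans_def)

lemma nat_trans_compose: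
  assumes "\<phi> \<in> nat_trans C R M N" "\<psi> \<in> nat_trans C R N L"
  shows "(\<lambda>x u. \<psi> x (\<phi> x u)) \<in> nat_trans C R M L"
proof (rule nat_transI)
  show "(\<lambda>u. \<psi> x (\<phi> x u)) \<in> mod_hom R (val M x) (val L x)" if "x \<in> Obj C" for x
    using nat_transD(1)[OF assms(1) that] nat_transD(1)[OF assms(2) that] by (rule mod_hom_compose)
qed (use nat_transD(2)[OF assms(1)] nat_transD(2)[OF assms(2)] nat_trans_closed[OF assms(1)] in simp)

lemma (in cat_module) act_closed:
  "x \<in> Obj C \<Longrightarrow> y \<in> Obj C \<Longrightarrow> f \<in> Hom C x y \<Longrightarrow> u \<in> carrier (val M x) \<Longrightarrow>
    act M x y f u \<in> carrier (val M y)"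
  using act_hom mod_homD(1) by metis

lemma finsum_free_module:
  assumes "cring R" "w \<in> F \<rightarrow> carrier (free_module R B)" "finite F"
  shows "(\<Oplus>\<^bsub>free_module R B\<^esub>f \<in> F. w f) h = (\<Oplus>\<^bsub>R\<^esub>f \<in> F. w f h)"
proof -
  interpret R: cring R by fact
  interpret M: module R "free_module R B" by (rule free_module_module) fact
  have coeff: "w f h \<in> carrier R" if "w f \<in> carrier (free_module R B)" for f
    using that by (simp add: free_module_carrier)
  show ?thesis using assms(3,2)
  proof (induction F)
    case (insert f F)
    then have "w f \<in> carrier (free_module R B)" "w \<in> F \<rightarrow> carrier (free_module R B)" by auto
    then show ?case using insert coeff by (simp add: Pi_def)
  qed simp
qed

lemma rep_module_val [simp]: "val (rep_module C R x) y = free_module R (Hom C x y)"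
  by (simp add: rep_module_def)

text \<open>Seen as a linear extension, the action is determined by its values on the basis, and
  functoriality and naturality need to be verified there only.\<close>

lemma rep_module_act:
  assumes "category C" "cring R" and obj: "x \<in> Obj C" "y \<in> Obj C" "z \<in> Obj C" and g: "g \<in> Hom C y z"
    and u: "u \<in> carrier (free_module R (Hom C x y))"
  shows "act (rep_module C R x) y z g u
    = linear_extension R (free_module R (Hom C x z)) (\<lambda>f. basis_elem R (Cmp C x y z g f)) u"
proof
  interpret category C by fact
  interpret R: cring R by fact
  interpret M: module R "free_module R (Hom C x z)" by (rule free_module_module) fact
  fix h
  let ?F = "{f. u f \<noteq> \<zero>\<^bsub>R\<^esub>}"
  have F: "finite ?F" "?F \<subseteq> Hom C x y" and coeff: "\<And>f. u f \<in> carrier R"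
    using u by (auto simp: free_module_carrier)
  have b: "basis_elem R (Cmp C x y z g f) \<in> carrier (free_module R (Hom C x z))" if "f \<in> ?F" for f
    using that F(2) by (intro basis_elem_carrier[OF assms(2)] Cmp_in_Hom[OF obj _ g]) auto
  have "linear_extension R (free_module R (Hom C x z)) (\<lambda>f. basis_elem R (Cmp C x y z g f)) u h
      = (\<Oplus>\<^bsub>R\<^esub>f \<in> ?F. (u f \<odot>\<^bsub>free_module R (Hom C x z)\<^esub> basis_elem R (Cmp C x y z g f)) h)"
    unfolding linear_extension_def by (rule finsum_free_module[OF assms(2) _ F(1)]) (intro funcsetI M.smult_closed coeff b)
  also have "\<dots> = (\<Oplus>\<^bsub>R\<^esub>f \<in> {f \<in> Hom C x y. u f \<noteq> \<zero>\<^bsub>R\<^esub> \<and> Cmp C x y z g f = h}. u f)"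
    by (rule R.add.finprod_mono_neutral_cong_right)
      (use F coeff in \<open>auto simp: basis_elem_def\<close>)
  finally show "act (rep_module C R x) y z g u h
      = linear_extension R (free_module R (Hom C x z)) (\<lambda>f. basis_elem R (Cmp C x y z g f)) u h"
    by (simp add: rep_module_def)
qed

lemma rep_module_act_hom:
  assumes "category C" "cring R" and obj: "x \<in> Obj C" "y \<in> Obj C" "z \<in> Obj C" and g: "g \<in> Hom C y z"
  shows "act (rep_module C R x) y z g \<in> mod_hom R (free_module R (Hom C x y)) (free_module R (Hom C x z))"
    and "f \<in> Hom C x y \<Longrightarrow> act (rep_module C R x) y z g (basis_elem R f) = basis_elem R (Cmp C x y z g f)"
proof -
  interpret category C by fact
  note FM = free_module_module[OF assms(2)]
  have b: "(\<lambda>f. basis_elem R (Cmp C x y z g f)) \<in> Hom C x y \<rightarrow> carrier (free_module R (Hom C x z))"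
    by (intro funcsetI basis_elem_carrier[OF assms(2)] Cmp_in_Hom[OF obj _ g])
  show "act (rep_module C R x) y z g \<in> mod_hom R (free_module R (Hom C x y)) (free_module R (Hom C x z))"
    using mod_hom_cong[OF FM linear_extension_hom[OF FM b]] rep_module_act[OF assms] by blast
  show "act (rep_module C R x) y z g (basis_elem R f) = basis_elem R (Cmp C x y z g f)"
    if f: "f \<in> Hom C x y"
    using rep_module_act[OF assms basis_elem_carrier[OF assms(2) f]] linear_extension_basis[OF FM b f] by simp
qed

lemma rep_module_cat_module:
  assumes "category C" "cring R" and x: "x \<in> Obj C"
  shows "cat_module C R (rep_module C R x)"
proof -
  interpret category C by fact
  note FM = free_module_module[OF assms(2)]
  note act = rep_module_act_hom[OF assms(1,2) x]
  show ?thesis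
  proof (intro cat_module.intro[OF category_axioms] cat_module_axioms.intro)
    fix y assume "y \<in> Obj C"
    show "module R (val (rep_module C R x) y)" using FM by simp
  next
    fix y z f assume "y \<in> Obj C" "z \<in> Obj C" "f \<in> Hom C y z"
    then show "act (rep_module C R x) y z f \<in> mod_hom R (val (rep_module C R x) y) (val (rep_module C R x) z)"
      using act by simp
  next
    fix y u assume y: "y \<in> Obj C" and u: "u \<in> carrier (val (rep_module C R x) y)"
    show "act (rep_module C R x) y y (Idn C y) u = u"
      by (rule free_hom_eqI[OF assms(2) FM act(1) mod_hom_id])
        (use y u x in \<open>simp_all add: act Idn_in_Hom Cmp_Idn_left\<close>)
  next
    fix y z w f g u
    assume obj: "y \<in> Obj C" "z \<in> Obj C" "w \<in> Obj C" and f: "f \<in> Hom C y z" and g: "g \<in> Hom C z w"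
      and u: "u \<in> carrier (val (rep_module C R x) y)"
    have gf: "Cmp C y z w g f \<in> Hom C y w" using Cmp_in_Hom obj f g by blast
    show "act (rep_module C R x) y w (Cmp C y z w g f) u
        = act (rep_module C R x) z w g (act (rep_module C R x) y z f u)"
    proof (rule free_hom_eqI[OF assms(2) FM act(1)[OF obj(1,3) gf]
          mod_hom_compose[OF act(1)[OF obj(1,2) f] act(1)[OF obj(2,3) g]]])
      fix h assume h: "h \<in> Hom C x y"
      have "Cmp C x y z f h \<in> Hom C x z" using Cmp_in_Hom x obj h f by blast
      then show "act (rep_module C R x) y w (Cmp C y z w g f) (basis_elem R h)
          = act (rep_module C R x) z w g (act (rep_module C R x) y z f (basis_elem R h))"
        using act(2) Cmp_assoc[OF x obj h f g] obj f g gf h by simp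
    qed (use u in simp)
  qed
qed

text \<open>The morphism out of a representable module that corresponds to an element under the Yoneda
  lemma, the correspondence being evaluation at the identity.\<close>

definition yoneda :: "('k, 'r) ring_scheme \<Rightarrow> ('o, 'a, 'k, 'm) cmod \<Rightarrow> 'o \<Rightarrow> 'm
    \<Rightarrow> 'o \<Rightarrow> ('a \<Rightarrow> 'k) \<Rightarrow> 'm" where
  "yoneda R M x v y = linear_extension R (val M y) (\<lambda>f. act M x y f v)"

lemma yoneda:
  assumes M: "cat_module C R M" and R: "cring R" and x: "x \<in> Obj C" and v: "v \<in> carrier (val M x)"
  shows "yoneda R M x v \<in> nat_trans C R (rep_module C R x) M"
    and "y \<in> Obj C \<Longrightarrow> f \<in> Hom C x y \<Longrightarrow> yoneda R M x v y (basis_elem R f) = act M x y f v"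
proof -
  interpret cat_module C R M by fact
  note act = rep_module_act_hom[OF category_axioms R x]
  have b: "(\<lambda>f. act M x y f v) \<in> Hom C x y \<rightarrow> carrier (val M y)" if "y \<in> Obj C" for y
    using act_closed x v that by blast
  have hom: "yoneda R M x v y \<in> mod_hom R (free_module R (Hom C x y)) (val M y)" if "y \<in> Obj C" for y
    unfolding yoneda_def by (rule linear_extension_hom[OF val_module b]) (use that in auto)
  show bas: "yoneda R M x v y (basis_elem R f) = act M x y f v" if "y \<in> Obj C" "f \<in> Hom C x y" for y f
    unfolding yoneda_def by (rule linear_extension_basis[OF val_module b]) (use that in auto)
  show "yoneda R M x v \<in> nat_trans C R (rep_module C R x) M"
  proof (rule nat_transI)
    fix y z g u assume obj: "y \<in> Obj C" "z \<in> Obj C" and g: "g \<in> Hom C y z"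
      and u: "u \<in> carrier (val (rep_module C R x) y)"
    show "yoneda R M x v z (act (rep_module C R x) y z g u) = act M y z g (yoneda R M x v y u)"
    proof (rule free_hom_eqI[OF R val_module[OF obj(2)] mod_hom_compose[OF act(1)[OF obj g] hom[OF obj(2)]]
          mod_hom_compose[OF hom[OF obj(1)] act_hom[OF obj g]]])
      fix f assume f: "f \<in> Hom C x y"
      then show "yoneda R M x v z (act (rep_module C R x) y z g (basis_elem R f))
          = act M y z g (yoneda R M x v y (basis_elem R f))"
        using act(2)[OF obj g f] bas obj Cmp_in_Hom[OF x obj f g] act_Cmp[OF x obj f g v] by simp
    qed (use u in simp)
  qed (use hom in simp)
qed

lemma nat_trans_rep_basis:
  assumes "category C" "cring R" "x \<in> Obj C" "y \<in> Obj C" "f \<in> Hom C x y"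
    and "\<phi> \<in> nat_trans C R (rep_module C R x) M"
  shows "\<phi> y (basis_elem R f) = act M x y f (\<phi> x (basis_elem R (Idn C x)))"
proof -
  interpret category C by fact
  have "basis_elem R f = act (rep_module C R x) x y f (basis_elem R (Idn C x))"
    using rep_module_act_hom(2)[OF assms(1,2,3,3,4,5) Idn_in_Hom] Cmp_Idn_right assms by simp
  moreover have "basis_elem R (Idn C x) \<in> carrier (val (rep_module C R x) x)"
    using basis_elem_carrier[OF assms(2) Idn_in_Hom[OF assms(3)]] by simp
  ultimately show ?thesis using nat_transD(2)[OF assms(6,3,4,5)] by metis
qed

lemma nat_trans_rep_eqI:
  assumes "cat_module C R M" "cring R" "x \<in> Obj C"
    and \<phi>: "\<phi> \<in> nat_trans C R (rep_module C R x) M" and \<psi>: "\<psi> \<in> nat_trans C R (rep_module C R x) M"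
    and eq: "\<phi> x (basis_elem R (Idn C x)) = \<psi> x (basis_elem R (Idn C x))"
    and y: "y \<in> Obj C" and u: "u \<in> carrier (val (rep_module C R x) y)"
  shows "\<phi> y u = \<psi> y u"
proof -
  interpret cat_module C R M by fact
  have "\<phi> y \<in> mod_hom R (free_module R (Hom C x y)) (val M y)"
    "\<psi> y \<in> mod_hom R (free_module R (Hom C x y)) (val M y)"
    using nat_transD(1)[OF \<phi> y] nat_transD(1)[OF \<psi> y] by simp_all
  then show ?thesis
  proof (rule free_hom_eqI[OF assms(2) val_module[OF y]])
    fix f assume "f \<in> Hom C x y"
    note basis = nat_trans_rep_basis[OF category_axioms assms(2,3) y this]
    show "\<phi> y (basis_elem R f) = \<psi> y (basis_elem R f)"
      using basis[OF \<phi>] basis[OF \<psi>] eq by simp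
  qed (use u in simp)
qed


section \<open>Quotient modules\<close>

lemma submodule_abelian_subgroup:
  assumes "module R M" "submodule N R M"
  shows "abelian_subgroup N M"
proof -
  interpret module R M by fact
  show ?thesis
    using assms(2) by (intro abelian_subgroupI3 additive_subgroup.intro)
      (auto simp: submodule_def M.abelian_group_axioms)
qed

text \<open>Scalar multiplication and the action of morphisms on a quotient are both defined on cosets in
  this form, which makes them the maps induced on representatives.\<close>

lemma coset_image:
  assumes f: "abelian_group_hom M M' f" and N: "abelian_subgroup N M" and N': "abelian_subgroup N' M'"
    and sub: "f ` N \<subseteq> N'" and u: "u \<in> carrier M"
  shows "N' <+>\<^bsub>M'\<^esub> (f ` (N +>\<^bsub>M\<^esub> u)) = N' +>\<^bsub>M'\<^esub> f u"
proof -
  interpret f: abelian_group_hom M M' f by fact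
  interpret N: abelian_subgroup N M by fact
  interpret N': abelian_subgroup N' M' by fact
  show ?thesis
  proof
    show "N' <+>\<^bsub>M'\<^esub> (f ` (N +>\<^bsub>M\<^esub> u)) \<subseteq> N' +>\<^bsub>M'\<^esub> f u"
    proof
      fix w assume "w \<in> N' <+>\<^bsub>M'\<^esub> (f ` (N +>\<^bsub>M\<^esub> u))"
      then obtain n' n where n: "n' \<in> N'" "n \<in> N" "w = n' \<oplus>\<^bsub>M'\<^esub> f (n \<oplus>\<^bsub>M\<^esub> u)"
        by (auto simp: set_add_def' a_r_coset_def')
      moreover have "f n \<in> N'" using n sub by auto
      ultimately have "w = (n' \<oplus>\<^bsub>M'\<^esub> f n) \<oplus>\<^bsub>M'\<^esub> f u" "n' \<oplus>\<^bsub>M'\<^esub> f n \<in> N'"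
        using u by (simp_all add: f.H.a_assoc)
      then show "w \<in> N' +>\<^bsub>M'\<^esub> f u" by (auto simp: a_r_coset_def')
    qed
    show "N' +>\<^bsub>M'\<^esub> f u \<subseteq> N' <+>\<^bsub>M'\<^esub> (f ` (N +>\<^bsub>M\<^esub> u))"
      using N.a_rcos_self[OF u] by (auto simp: set_add_def' a_r_coset_def'[of _ N'])
  qed
qed

lemma quotient_module_simps:
  "carrier (quotient_module M N) = a_rcosets\<^bsub>M\<^esub> N"
  "\<zero>\<^bsub>quotient_module M N\<^esub> = N"
  "X \<oplus>\<^bsub>quotient_module M N\<^esub> Y = X <+>\<^bsub>M\<^esub> Y"
  "r \<odot>\<^bsub>quotient_module M N\<^esub> X = N <+>\<^bsub>M\<^esub> ((\<lambda>u. r \<odot>\<^bsub>M\<^esub> u) ` X)"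
  by (simp_all add: quotient_module_def)

lemma quotient_module_carrier: "carrier (quotient_module M N) = (\<lambda>u. N +>\<^bsub>M\<^esub> u) ` carrier M"
  by (auto simp: quotient_module_simps A_RCOSETS_def')

lemma smult_group_hom:
  fixes M :: "('k, 'm) module"
  assumes "module R M" "r \<in> carrier R"
  shows "abelian_group_hom M M (\<lambda>u. r \<odot>\<^bsub>M\<^esub> u)"
proof -
  interpret module R M by fact
  have "(\<lambda>u. r \<odot>\<^bsub>M\<^esub> u) \<in> mod_hom R M M"
    by (rule mod_homI) (use assms(2) in \<open>auto simp: smult_r_distr smult_assoc1[symmetric] R.m_comm\<close>)
  then show ?thesis using mod_hom_group_hom assms(1) by blast
qed

lemma quotient_module_smult:
  assumes M: "module R M" and N: "submodule N R M" and r: "r \<in> carrier R" and u: "u \<in> carrier M"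
  shows "r \<odot>\<^bsub>quotient_module M N\<^esub> (N +>\<^bsub>M\<^esub> u) = N +>\<^bsub>M\<^esub> (r \<odot>\<^bsub>M\<^esub> u)"
  unfolding quotient_module_simps
  by (rule coset_image[OF smult_group_hom[OF M r] submodule_abelian_subgroup[OF M N]
        submodule_abelian_subgroup[OF M N] _ u])
    (use submodule.smult_closed[OF N r] in auto)

lemma quotient_module_add:
  assumes M: "module R M" and N: "submodule N R M" and "u \<in> carrier M" "v \<in> carrier M"
  shows "(N +>\<^bsub>M\<^esub> u) \<oplus>\<^bsub>quotient_module M N\<^esub> (N +>\<^bsub>M\<^esub> v) = N +>\<^bsub>M\<^esub> (u \<oplus>\<^bsub>M\<^esub> v)"
  using abelian_subgroup.a_rcos_sum[OF submodule_abelian_subgroup[OF M N]] assms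
  by (simp add: quotient_module_simps)

lemma quotient_module_module:
  assumes M: "module R M" and N: "submodule N R M"
  shows "module R (quotient_module M N)"
proof -
  interpret module R M by fact
  interpret N: abelian_subgroup N M by (rule submodule_abelian_subgroup[OF M N])
  let ?Q = "quotient_module M N"
  note add = quotient_module_add[OF M N]
  have zero: "\<zero>\<^bsub>?Q\<^esub> = N +>\<^bsub>M\<^esub> \<zero>\<^bsub>M\<^esub>" using N.a_subset by (simp add: quotient_module_simps)
  have "abelian_group ?Q"
  proof (rule abelian_groupI; unfold quotient_module_carrier zero; (elim imageE; hypsubst)?)
    show "\<exists>V \<in> (\<lambda>u. N +>\<^bsub>M\<^esub> u) ` carrier M. V \<oplus>\<^bsub>?Q\<^esub> (N +>\<^bsub>M\<^esub> u) = N +>\<^bsub>M\<^esub> \<zero>\<^bsub>M\<^esub>"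
      if "u \<in> carrier M" for u
      using that add[of "\<ominus>\<^bsub>M\<^esub> u" u] by (intro bexI[of _ "N +>\<^bsub>M\<^esub> (\<ominus>\<^bsub>M\<^esub> u)"]) (auto simp: M.l_neg)
  qed (auto simp: add M.a_ac)
  then show ?thesis
    by (intro moduleI R.is_cring)
      (auto simp: quotient_module_carrier quotient_module_smult[OF M N] quotient_module_add[OF M N]
        smult_l_distr smult_r_distr smult_assoc1)
qed

lemma quotient_projection_hom:
  assumes "module R M" "submodule N R M"
  shows "(\<lambda>u. N +>\<^bsub>M\<^esub> u) \<in> mod_hom R M (quotient_module M N)"
  by (rule mod_homI)
    (simp_all add: quotient_module_smult[OF assms] quotient_module_add[OF assms] quotient_module_carrier)

lemma coset_eq_zero:
  assumes "module R M" "submodule N R M" "u \<in> carrier M" "u \<in> N"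
  shows "N +>\<^bsub>M\<^esub> u = \<zero>\<^bsub>quotient_module M N\<^esub>"
  using abelian_subgroup.a_rcos_const[OF submodule_abelian_subgroup[OF assms(1,2)] assms(4)]
  by (simp add: quotient_module_simps)

lemma submodule_familyD:
  assumes "submodule_family C R M N"
  shows "x \<in> Obj C \<Longrightarrow> submodule (N x) R (val M x)"
    and "x \<in> Obj C \<Longrightarrow> y \<in> Obj C \<Longrightarrow> f \<in> Hom C x y \<Longrightarrow> act M x y f ` N x \<subseteq> N y"
  using assms by (auto simp: submodule_family_def)

lemma quotient_cmod_simps [simp]:
  "val (quotient_cmod M N) x = quotient_module (val M x) (N x)"
  "act (quotient_cmod M N) x y f X = N y <+>\<^bsub>val M y\<^esub> (act M x y f ` X)"
  by (simp_all add: quotient_cmod_def)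

context cat_module
begin

lemma quotient_act:
  assumes N: "submodule_family C R M N" and xy: "x \<in> Obj C" "y \<in> Obj C" and f: "f \<in> Hom C x y"
    and u: "u \<in> carrier (val M x)"
  shows "act (quotient_cmod M N) x y f (N x +>\<^bsub>val M x\<^esub> u) = N y +>\<^bsub>val M y\<^esub> act M x y f u"
  unfolding quotient_cmod_simps
  by (rule coset_image[OF mod_hom_group_hom[OF val_module val_module act_hom]
        submodule_abelian_subgroup[OF val_module] submodule_abelian_subgroup[OF val_module] _ u])
    (use submodule_familyD[OF N] xy f in auto)

lemma quotient_cat_module:
  assumes N: "submodule_family C R M N"
  shows "cat_module C R (quotient_cmod M N)"
proof (intro cat_module.intro[OF category_axioms] cat_module_axioms.intro)
  note sub = submodule_familyD(1)[OF N]
  fix x assume x: "x \<in> Obj C"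
  show "module R (val (quotient_cmod M N) x)"
    using quotient_module_module[OF val_module sub] x by simp
next
  note sub = submodule_familyD(1)[OF N]
  fix x y f assume xy: "x \<in> Obj C" "y \<in> Obj C" and f: "f \<in> Hom C x y"
  note h = mod_homD[OF act_hom[OF xy f]]
  show "act (quotient_cmod M N) x y f \<in> mod_hom R (val (quotient_cmod M N) x) (val (quotient_cmod M N) y)"
  proof (rule mod_homI; unfold quotient_cmod_simps(1) quotient_module_carrier; elim imageE; hypsubst)
    fix u assume u: "u \<in> carrier (val M x)"
    show "act (quotient_cmod M N) x y f (N x +>\<^bsub>val M x\<^esub> u) \<in> (\<lambda>u. N y +>\<^bsub>val M y\<^esub> u) ` carrier (val M y)"
      using quotient_act[OF N xy f u] h(1)[OF u] by simp
    fix v assume v: "v \<in> carrier (val M x)"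
    have "u \<oplus>\<^bsub>val M x\<^esub> v \<in> carrier (val M x)"
      using abelian_groupE(1) module.axioms(2)[OF val_module[OF xy(1)]] u v by metis
    then show "act (quotient_cmod M N) x y f
        ((N x +>\<^bsub>val M x\<^esub> u) \<oplus>\<^bsub>quotient_module (val M x) (N x)\<^esub> (N x +>\<^bsub>val M x\<^esub> v))
      = act (quotient_cmod M N) x y f (N x +>\<^bsub>val M x\<^esub> u)
        \<oplus>\<^bsub>quotient_module (val M y) (N y)\<^esub> act (quotient_cmod M N) x y f (N x +>\<^bsub>val M x\<^esub> v)"
      using quotient_module_add[OF val_module sub] quotient_act[OF N xy f] xy u v h by metis
  next
    fix r u assume r: "r \<in> carrier R" and u: "u \<in> carrier (val M x)"
    have "r \<odot>\<^bsub>val M x\<^esub> u \<in> carrier (val M x)"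
      using module.smult_closed[OF val_module[OF xy(1)] r u] .
    then show "act (quotient_cmod M N) x y f (r \<odot>\<^bsub>quotient_module (val M x) (N x)\<^esub> (N x +>\<^bsub>val M x\<^esub> u))
        = r \<odot>\<^bsub>quotient_module (val M y) (N y)\<^esub> act (quotient_cmod M N) x y f (N x +>\<^bsub>val M x\<^esub> u)"
      using quotient_module_smult[OF val_module sub r] quotient_act[OF N xy f] xy u h r by metis
  qed
next
  fix x U assume x: "x \<in> Obj C" and "U \<in> carrier (val (quotient_cmod M N) x)"
  then obtain u where u: "u \<in> carrier (val M x)" "U = N x +>\<^bsub>val M x\<^esub> u"
    by (auto simp: quotient_module_carrier)
  then show "act (quotient_cmod M N) x x (Idn C x) U = U"
    using quotient_act[OF N x x Idn_in_Hom[OF x] u(1)] act_Idn[OF x u(1)] by metis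
next
  fix x y z f g U
  assume obj: "x \<in> Obj C" "y \<in> Obj C" "z \<in> Obj C" and fg: "f \<in> Hom C x y" "g \<in> Hom C y z"
    and "U \<in> carrier (val (quotient_cmod M N) x)"
  then obtain u where u: "u \<in> carrier (val M x)" "U = N x +>\<^bsub>val M x\<^esub> u"
    by (auto simp: quotient_module_carrier)
  show "act (quotient_cmod M N) x z (Cmp C x y z g f) U
      = act (quotient_cmod M N) y z g (act (quotient_cmod M N) x y f U)"
    unfolding u(2) quotient_act[OF N obj(1,3) Cmp_in_Hom[OF obj fg] u(1)]
      quotient_act[OF N obj(1,2) fg(1) u(1)]
      quotient_act[OF N obj(2,3) fg(2) act_closed[OF obj(1,2) fg(1) u(1)]]
    by (simp add: act_Cmp[OF obj fg u(1)])
qed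

lemma quotient_projection:
  assumes N: "submodule_family C R M N"
  shows "(\<lambda>x u. N x +>\<^bsub>val M x\<^esub> u) \<in> nat_trans C R M (quotient_cmod M N)"
proof (rule nat_transI)
  show "(\<lambda>u. N x +>\<^bsub>val M x\<^esub> u) \<in> mod_hom R (val M x) (val (quotient_cmod M N) x)" if "x \<in> Obj C" for x
    using quotient_projection_hom[OF val_module submodule_familyD(1)[OF N]] that by simp
qed (use quotient_act[OF N] in metis)

lemma quotient_factor:
  assumes N: "submodule_family C R M N" and L: "cat_module C R L" and \<phi>: "\<phi> \<in> nat_trans C R M L"
    and zero: "\<And>x u. x \<in> Obj C \<Longrightarrow> u \<in> N x \<Longrightarrow> \<phi> x u = \<zero>\<^bsub>val L x\<^esub>"
  obtains \<psi> where "\<psi> \<in> nat_trans C R (quotient_cmod M N) L"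
    and "\<And>x u. x \<in> Obj C \<Longrightarrow> u \<in> carrier (val M x) \<Longrightarrow> \<psi> x (N x +>\<^bsub>val M x\<^esub> u) = \<phi> x u"
proof
  define \<psi> where "\<psi> x U = \<phi> x (SOME u. u \<in> U)" for x U
  interpret L: cat_module C R L by fact
  show \<psi>: "\<psi> x (N x +>\<^bsub>val M x\<^esub> u) = \<phi> x u" if x: "x \<in> Obj C" and u: "u \<in> carrier (val M x)" for x u
  proof -
    interpret N: abelian_subgroup "N x" "val M x"
      using submodule_abelian_subgroup[OF val_module[OF x] submodule_familyD(1)[OF N x]] .
    interpret h: abelian_group_hom "val M x" "val L x" "\<phi> x"
      using mod_hom_group_hom[OF val_module[OF x] L.val_module[OF x] nat_transD(1)[OF \<phi> x]] .
    have "(SOME w. w \<in> N x +>\<^bsub>val M x\<^esub> u) \<in> N x +>\<^bsub>val M x\<^esub> u"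
      by (rule someI) (rule N.a_rcos_self[OF u])
    then obtain n where n: "n \<in> N x" "(SOME w. w \<in> N x +>\<^bsub>val M x\<^esub> u) = n \<oplus>\<^bsub>val M x\<^esub> u"
      by (auto simp: a_r_coset_def')
    then show ?thesis using zero[OF x n(1)] u by (simp add: \<psi>_def)
  qed
  show "\<psi> \<in> nat_trans C R (quotient_cmod M N) L"
  proof (rule nat_transI)
    fix x assume x: "x \<in> Obj C"
    note M = val_module[OF x] and sub = submodule_familyD(1)[OF N x] and h = mod_homD[OF nat_transD(1)[OF \<phi> x]]
    interpret module R "val M x" by (rule M)
    show "\<psi> x \<in> mod_hom R (val (quotient_cmod M N) x) (val L x)"
      by (rule mod_homI; unfold quotient_cmod_simps(1) quotient_module_carrier; elim imageE; hypsubst)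
        (simp_all add: quotient_module_smult[OF M sub] quotient_module_add[OF M sub] \<psi>[OF x] h)
  next
    fix x y f U assume xy: "x \<in> Obj C" "y \<in> Obj C" and f: "f \<in> Hom C x y"
      and "U \<in> carrier (val (quotient_cmod M N) x)"
    then obtain u where u: "u \<in> carrier (val M x)" "U = N x +>\<^bsub>val M x\<^esub> u"
      by (auto simp: quotient_module_carrier)
    show "\<psi> y (act (quotient_cmod M N) x y f U) = act L x y f (\<psi> x U)"
      unfolding u(2) quotient_act[OF N xy f u(1)] \<psi>[OF xy(1) u(1)] \<psi>[OF xy(2) act_closed[OF xy f u(1)]]
      by (rule nat_transD(2)[OF \<phi> xy f u(1)])
  qed
qed

lemma kernel_submodule_family:
  assumes L: "cat_module C R L" and \<phi>: "\<phi> \<in> nat_trans C R M L"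
  shows "submodule_family C R M (\<lambda>x. {u \<in> carrier (val M x). \<phi> x u = \<zero>\<^bsub>val L x\<^esub>})"
  unfolding submodule_family_def
proof (intro conjI ballI)
  interpret L: cat_module C R L by fact
  fix x assume x: "x \<in> Obj C"
  interpret M: module R "val M x" by (rule val_module[OF x])
  interpret Lx: module R "val L x" by (rule L.val_module[OF x])
  interpret h: abelian_group_hom "val M x" "val L x" "\<phi> x"
    using mod_hom_group_hom[OF val_module[OF x] L.val_module[OF x] nat_transD(1)[OF \<phi> x]] .
  show "submodule {u \<in> carrier (val M x). \<phi> x u = \<zero>\<^bsub>val L x\<^esub>} R (val M x)"
    by (rule M.submoduleI) (use mod_homD(3)[OF nat_transD(1)[OF \<phi> x]] in auto)
next
  interpret L: cat_module C R L by fact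
  fix x y f assume xy: "x \<in> Obj C" "y \<in> Obj C" and f: "f \<in> Hom C x y"
  have "act L x y f \<zero>\<^bsub>val L x\<^esub> = \<zero>\<^bsub>val L y\<^esub>"
    using abelian_group_hom.hom_zero mod_hom_group_hom L.val_module L.act_hom xy f by metis
  then show "act M x y f ` {u \<in> carrier (val M x). \<phi> x u = \<zero>\<^bsub>val L x\<^esub>}
      \<subseteq> {u \<in> carrier (val M y). \<phi> y u = \<zero>\<^bsub>val L y\<^esub>}"
    using act_closed[OF xy f] nat_transD(2)[OF \<phi> xy f] by auto
qed

lemma generated_submodule_family:
  assumes X: "\<And>x. x \<in> Obj C \<Longrightarrow> X x \<subseteq> carrier (val M x)"
  shows "submodule_family C R M (generated_submodule C R M X)"
proof -
  have top: "submodule_family C R M (\<lambda>x. carrier (val M x))"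
    unfolding submodule_family_def using module.carrier_is_submodule[OF val_module] act_closed by blast
  let ?G = "\<lambda>x. {N x | N. submodule_family C R M N \<and> (\<forall>y \<in> Obj C. X y \<subseteq> N y)}"
  have ne: "carrier (val M x) \<in> ?G x" for x
    by (intro CollectI exI[of _ "\<lambda>x. carrier (val M x)"] conjI refl top ballI X)
  show ?thesis
    unfolding submodule_family_def[of C R M "generated_submodule C R M X"] generated_submodule_def
  proof (intro conjI ballI)
    fix x assume x: "x \<in> Obj C"
    interpret module R "val M x" by (rule val_module[OF x])
    have sub: "submodule N R (val M x)" if "N \<in> ?G x" for N
      using that submodule_familyD(1)[OF _ x] by (elim CollectE exE conjE) simp
    note E = submoduleE[OF sub]
    have zero: "\<zero>\<^bsub>val M x\<^esub> \<in> N" if "N \<in> ?G x" for N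
      using subgroup.one_closed[OF submodule.axioms(1)[OF sub[OF that]]] by simp
    show "submodule (\<Inter> (?G x)) R (val M x)"
    proof (rule submoduleI)
      show "\<Inter> (?G x) \<subseteq> carrier (val M x)" by (rule Inter_lower[OF ne])
      show "\<zero>\<^bsub>val M x\<^esub> \<in> \<Inter> (?G x)" using zero by (rule InterI)
      show "\<ominus>\<^bsub>val M x\<^esub> a \<in> \<Inter> (?G x)" if "a \<in> \<Inter> (?G x)" for a
        by (rule InterI) (rule E(3)[OF _ InterD[OF that]])
      show "a \<oplus>\<^bsub>val M x\<^esub> b \<in> \<Inter> (?G x)" if "a \<in> \<Inter> (?G x)" "b \<in> \<Inter> (?G x)" for a b
        by (rule InterI) (rule E(5)[OF _ InterD[OF that(1)] InterD[OF that(2)]])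
      show "r \<odot>\<^bsub>val M x\<^esub> a \<in> \<Inter> (?G x)" if "r \<in> carrier R" "a \<in> \<Inter> (?G x)" for r a
        by (rule InterI) (rule E(4)[OF _ that(1) InterD[OF that(2)]])
    qed
  next
    fix x y f assume xy: "x \<in> Obj C" "y \<in> Obj C" and f: "f \<in> Hom C x y"
    have "act M x y f u \<in> N y"
      if u: "u \<in> \<Inter> (?G x)" and N: "submodule_family C R M N" "\<forall>y \<in> Obj C. X y \<subseteq> N y" for u N
    proof -
      have "u \<in> N x" using u N by blast
      then show ?thesis using submodule_familyD(2)[OF N(1) xy f] by blast
    qed
    then show "act M x y f ` \<Inter> (?G x) \<subseteq> \<Inter> (?G y)" by blast
  qed
qed

lemma generated_submodule_least:
  assumes "submodule_family C R M N" "\<And>y. y \<in> Obj C \<Longrightarrow> X y \<subseteq> N y"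
  shows "generated_submodule C R M X x \<subseteq> N x"
  unfolding generated_submodule_def using assms by blast

end

lemma generated_submodule_base: "x \<in> Obj C \<Longrightarrow> X x \<subseteq> generated_submodule C R M X x"
  unfolding generated_submodule_def by blast


section \<open>Standard modules\<close>

text \<open>A morphism out of the standard module is determined by its value here, as one out of the
  representable module is by its value at the identity.\<close>

definition standard_generator ::
  "('o, 'a) cat \<Rightarrow> ('o \<Rightarrow> 'o \<Rightarrow> 'a set) \<Rightarrow> ('k, 'r) ring_scheme \<Rightarrow> 'o \<Rightarrow> ('a \<Rightarrow> 'k) set" where
  "standard_generator C Cm R x =
     reedy_submodule C Cm R x x +>\<^bsub>free_module R (Hom C x x)\<^esub> basis_elem R (Idn C x)"

lemma wide_subcategory_sub:
  "wide_subcategory C Cm \<Longrightarrow> x \<in> Obj C \<Longrightarrow> y \<in> Obj C \<Longrightarrow> Cm x y \<subseteq> Hom C x y"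
  by (simp add: wide_subcategory_def)

lemma reedy_submodule_family:
  assumes C: "category C" and R: "cring R" and x: "x \<in> Obj C"
    and Cm: "wide_subcategory C Cm"
  shows "submodule_family C R (rep_module C R x) (reedy_submodule C Cm R x)"
proof -
  interpret cat_module C R "rep_module C R x" by (rule rep_module_cat_module[OF assms(1-3)])
  show ?thesis
    unfolding reedy_submodule_def
    by (rule generated_submodule_family) (use wide_subcategory_sub[OF Cm x] in \<open>auto intro!: basis_elem_carrier[OF R]\<close>)
qed

lemma standard_module_cat_module:
  assumes "category C" "cring R" "x \<in> Obj C" "wide_subcategory C Cm"
  shows "cat_module C R (standard_module C Cm R x)"
  unfolding standard_module_def
  by (rule cat_module.quotient_cat_module[OF rep_module_cat_module[OF assms(1-3)] reedy_submodule_family[OF assms]])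

lemma standard_projection:
  assumes "category C" "cring R" "x \<in> Obj C" "wide_subcategory C Cm"
  shows "(\<lambda>y u. reedy_submodule C Cm R x y +>\<^bsub>free_module R (Hom C x y)\<^esub> u)
    \<in> nat_trans C R (rep_module C R x) (standard_module C Cm R x)"
  using cat_module.quotient_projection[OF rep_module_cat_module[OF assms(1-3)]
      reedy_submodule_family[OF assms]]
  by (simp add: standard_module_def)

lemma identity_basis:
  assumes "category C" "cring R" "x \<in> Obj C"
  shows "basis_elem R (Idn C x) \<in> carrier (val (rep_module C R x) x)"
  using basis_elem_carrier[OF assms(2) category.Idn_in_Hom[OF assms(1,3)]] by simp

lemma standard_generator_carrier:
  assumes "category C" "cring R" "x \<in> Obj C" "wide_subcategory C Cm"
  shows "standard_generator C Cm R x \<in> carrier (val (standard_module C Cm R x) x)"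
  unfolding standard_generator_def
  by (rule nat_trans_closed[OF standard_projection[OF assms] assms(3) identity_basis[OF assms(1-3)]])

text \<open>This lemma and the two after it give the universal property of the standard module: its
  morphisms to a module \<open>M\<close> are the elements of \<open>M x\<close> annihilated by all
  non-invertible morphisms in \<open>Cm\<close>.\<close>

lemma standard_generator_killed:
  assumes C: "category C" "cring R" "x \<in> Obj C" "wide_subcategory C Cm"
    and M: "cat_module C R M" and h: "h \<in> nat_trans C R (standard_module C Cm R x) M"
    and y: "y \<in> Obj C" and m: "m \<in> Cm x y" "\<not> invertible C x y m"
  shows "act M x y m (h x (standard_generator C Cm R x)) = \<zero>\<^bsub>val M y\<^esub>"
proof -
  interpret S: cat_module C R "standard_module C Cm R x" by (rule standard_module_cat_module[OF C])
  interpret P: cat_module C R "rep_module C R x" by (rule rep_module_cat_module[OF C(1-3)])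
  interpret M: cat_module C R M by (rule M)
  let ?N = "reedy_submodule C Cm R x"
  note fam = reedy_submodule_family[OF C]
  have mH: "m \<in> Hom C x y" using m(1) wide_subcategory_sub[OF C(4,3) y] by blast
  note bas = basis_elem_carrier[OF C(2) mH]
  have "basis_elem R m \<in> ?N y"
    unfolding reedy_submodule_def using generated_submodule_base[OF y] m by fast
  then have zero: "?N y +>\<^bsub>free_module R (Hom C x y)\<^esub> basis_elem R m
      = \<zero>\<^bsub>val (standard_module C Cm R x) y\<^esub>"
    using coset_eq_zero[OF P.val_module[OF y] submodule_familyD(1)[OF fam y]] bas
    by (simp add: standard_module_def)
  have "act (standard_module C Cm R x) x y m (standard_generator C Cm R x)
      = ?N y +>\<^bsub>free_module R (Hom C x y)\<^esub> act (rep_module C R x) x y m (basis_elem R (Idn C x))"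
    unfolding standard_generator_def
    by (rule nat_transD(2)[OF standard_projection[OF C] C(3) y mH identity_basis[OF C(1-3)], symmetric])
  also have "act (rep_module C R x) x y m (basis_elem R (Idn C x)) = basis_elem R m"
    using rep_module_act_hom(2)[OF C(1,2,3,3) y mH S.Idn_in_Hom[OF C(3)]] S.Cmp_Idn_right[OF C(3) y mH]
    by simp
  finally have "act M x y m (h x (standard_generator C Cm R x)) = h y \<zero>\<^bsub>val (standard_module C Cm R x) y\<^esub>"
    using nat_transD(2)[OF h C(3) y mH standard_generator_carrier[OF C]] zero by simp
  also have "\<dots> = \<zero>\<^bsub>val M y\<^esub>"
    using abelian_group_hom.hom_zero[OF mod_hom_group_hom[OF S.val_module[OF y] M.val_module[OF y]
          nat_transD(1)[OF h y]]] .
  finally show ?thesis .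
qed

text \<open>The Yoneda morphism of the given element has a kernel that is stable under all morphisms and
  contains the generators of the submodule divided out, hence the whole of it.\<close>

lemma standard_hom_exists:
  assumes C: "category C" "cring R" "x \<in> Obj C" "wide_subcategory C Cm"
    and M: "cat_module C R M" and v: "v \<in> carrier (val M x)"
    and kill: "\<And>y m. y \<in> Obj C \<Longrightarrow> m \<in> Cm x y \<Longrightarrow> \<not> invertible C x y m \<Longrightarrow> act M x y m v = \<zero>\<^bsub>val M y\<^esub>"
  obtains h where "h \<in> nat_trans C R (standard_module C Cm R x) M"
    and "h x (standard_generator C Cm R x) = v"
proof -
  interpret P: cat_module C R "rep_module C R x" by (rule rep_module_cat_module[OF C(1-3)])
  interpret M: cat_module C R M by (rule M)
  let ?N = "reedy_submodule C Cm R x" and ?y = "yoneda R M x v"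
  note fam = reedy_submodule_family[OF C]
  note y = yoneda[OF M C(2,3) v]
  note ker = P.kernel_submodule_family[OF M y(1)]
  have "?N z \<subseteq> {u \<in> carrier (val (rep_module C R x) z). ?y z u = \<zero>\<^bsub>val M z\<^esub>}" for z
    unfolding reedy_submodule_def
  proof (rule P.generated_submodule_least[OF ker])
    fix z assume z: "z \<in> Obj C"
    show "{basis_elem R f |f. f \<in> Cm x z \<and> \<not> invertible C x z f}
        \<subseteq> {u \<in> carrier (val (rep_module C R x) z). ?y z u = \<zero>\<^bsub>val M z\<^esub>}"
    proof
      fix u assume "u \<in> {basis_elem R f |f. f \<in> Cm x z \<and> \<not> invertible C x z f}"
      then obtain f where f: "u = basis_elem R f" "f \<in> Cm x z" "\<not> invertible C x z f" by blast
      have fH: "f \<in> Hom C x z" using f(2) wide_subcategory_sub[OF C(4,3) z] by blast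
      show "u \<in> {u \<in> carrier (val (rep_module C R x) z). ?y z u = \<zero>\<^bsub>val M z\<^esub>}"
        using y(2)[OF z fH] kill[OF z f(2,3)] basis_elem_carrier[OF C(2) fH] f(1) by simp
    qed
  qed
  then have zero: "?y z u = \<zero>\<^bsub>val M z\<^esub>" if "u \<in> ?N z" for z u using that by auto
  obtain h where h: "h \<in> nat_trans C R (quotient_cmod (rep_module C R x) ?N) M"
    "\<And>z u. z \<in> Obj C \<Longrightarrow> u \<in> carrier (val (rep_module C R x) z) \<Longrightarrow>
      h z (?N z +>\<^bsub>val (rep_module C R x) z\<^esub> u) = ?y z u"
    using P.quotient_factor[OF fam M y(1)] zero by metis
  have "h x (standard_generator C Cm R x) = v"
    using h(2)[OF C(3) identity_basis[OF C(1-3)]] y(2)[OF C(3) P.Idn_in_Hom[OF C(3)]] M.act_Idn[OF C(3) v]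
    by (simp add: standard_generator_def)
  then show thesis using that h(1) by (simp add: standard_module_def)
qed

lemma standard_hom_eqI:
  assumes C: "category C" "cring R" "x \<in> Obj C" "wide_subcategory C Cm"
    and M: "cat_module C R M" and h: "h \<in> nat_trans C R (standard_module C Cm R x) M"
    and h': "h' \<in> nat_trans C R (standard_module C Cm R x) M"
    and eq: "h x (standard_generator C Cm R x) = h' x (standard_generator C Cm R x)"
    and y: "y \<in> Obj C" and U: "U \<in> carrier (val (standard_module C Cm R x) y)"
  shows "h y U = h' y U"
proof -
  obtain u where u: "u \<in> carrier (val (rep_module C R x) y)"
    "U = reedy_submodule C Cm R x y +>\<^bsub>free_module R (Hom C x y)\<^esub> u"
    using U by (auto simp: standard_module_def quotient_module_carrier)
  show ?thesis
    unfolding u(2)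
    by (rule nat_trans_rep_eqI[OF M C(2,3) nat_trans_compose[OF standard_projection[OF C] h]
          nat_trans_compose[OF standard_projection[OF C] h'] _ y u(1)])
      (use eq in \<open>simp add: standard_generator_def\<close>)
qed


section \<open>Elements annihilated by a family of idempotents\<close>

text \<open>Subtracting \<open>p e w\<close> from \<open>w\<close> yields an element annihilated by the
  idempotent \<open>p e\<close>, but it might spoil what was achieved for the other idempotents.
  It does not if \<open>e\<close> has a maximal position and is treated last: the relation then
  gives \<open>p e' (p e w) = p e' (p e (p e' w)) = 0\<close> for those \<open>e'\<close> that
  annihilate \<open>w\<close>. The predicate \<open>P\<close> records which property of the
  initial element is to survive the subtractions.\<close>

lemma exists_annihilated:
  assumes M: "abelian_group M" and A: "Partial_order A" and fin: "finite L"
    and p: "\<And>e. e \<in> L \<Longrightarrow> abelian_group_hom M M (p e)"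
    and idem: "\<And>e w. e \<in> L \<Longrightarrow> w \<in> carrier M \<Longrightarrow> p e (p e w) = p e w"
    and braid: "\<And>e e' w. e \<in> L \<Longrightarrow> e' \<in> L \<Longrightarrow> e' \<noteq> e \<Longrightarrow>
      ((pos e, pos e') \<in> A \<Longrightarrow> pos e' = pos e) \<Longrightarrow> w \<in> carrier M \<Longrightarrow>
      p e' (p e (p e' w)) = p e' (p e w)"
    and u: "u \<in> carrier M" "P u"
    and step: "\<And>e w. e \<in> L \<Longrightarrow> w \<in> carrier M \<Longrightarrow> P w \<Longrightarrow> P (w \<ominus>\<^bsub>M\<^esub> p e w)"
  shows "\<exists>v \<in> carrier M. P v \<and> (\<forall>e \<in> L. p e v = \<zero>\<^bsub>M\<^esub>)"
  using fin p idem braid step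
proof (induction L rule: finite_psubset_induct)
  case (psubset L)
  interpret abelian_group M by (rule M)
  show ?case
  proof (cases "L = {}")
    case True
    then show ?thesis using u by blast
  next
    case False
    then obtain e where e: "e \<in> L" "\<And>e'. e' \<in> L \<Longrightarrow> (pos e, pos e') \<in> A \<Longrightarrow> pos e' = pos e"
      using finite_maximal[OF A, of "pos ` L"] psubset.hyps by auto
    have "\<exists>v \<in> carrier M. P v \<and> (\<forall>e' \<in> L - {e}. p e' v = \<zero>\<^bsub>M\<^esub>)"
      by (rule psubset.IH) (use e(1) psubset.prems in auto)
    then obtain w where w: "w \<in> carrier M" "P w" "\<And>e'. e' \<in> L - {e} \<Longrightarrow> p e' w = \<zero>\<^bsub>M\<^esub>" by blast
    interpret pe: abelian_group_hom M M "p e" by (rule psubset.prems(1)[OF e(1)])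
    let ?v = "w \<ominus>\<^bsub>M\<^esub> p e w"
    have "p e' ?v = \<zero>\<^bsub>M\<^esub>" if e': "e' \<in> L" for e'
    proof -
      interpret pe': abelian_group_hom M M "p e'" by (rule psubset.prems(1)[OF e'])
      have eq: "p e' ?v = p e' w \<ominus>\<^bsub>M\<^esub> p e' (p e w)" using w(1) by (simp add: minus_eq)
      show ?thesis
      proof (cases "e' = e")
        case True
        then show ?thesis using eq psubset.prems(2)[OF e(1) w(1)] w(1) by (simp add: minus_eq r_neg)
      next
        case False
        then have "p e' w = \<zero>\<^bsub>M\<^esub>" using w(3) e' by blast
        moreover from this have "p e' (p e w) = \<zero>\<^bsub>M\<^esub>"
          using psubset.prems(3)[OF e(1) e' False e(2)[OF e'] w(1)] by simp
        ultimately show ?thesis using eq by (simp add: minus_eq)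
      qed
    qed
    moreover have "P ?v" using psubset.prems(4) e(1) w by blast
    moreover have "?v \<in> carrier M" using w(1) by simp
    ultimately show ?thesis by blast
  qed
qed


section \<open>Categories of trees\<close>

text \<open>The full subcategories on sets of trees that meet every isomorphism class comprise both the
  category of all trees and its skeletons, so that one argument covers the two.\<close>

definition iso_dense :: "nat rel set \<Rightarrow> bool" where
  "iso_dense S \<longleftrightarrow> S \<subseteq> {A. rooted_tree A} \<and> (\<forall>A :: nat rel. rooted_tree A \<longrightarrow> (\<exists>B \<in> S. \<exists>f. poset_iso A B f))"

abbreviation "Trees S \<equiv> full_subcat Tree_cat S"

lemma Trees_simps [simp]:
  "Obj (Trees S) = S"
  "Hom (Trees S) A B = {f. tree_mor A B f}"
  "Cmp (Trees S) A B D g f = compose (Field A) g f"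
  "Idn (Trees S) A = restrict id (Field A)"
  by (simp_all add: full_subcat_def Tree_cat_def)

lemma Tree_cat_eq: "Tree_cat = Trees {A. rooted_tree A}"
  by (simp add: full_subcat_def Tree_cat_def)

lemma iso_dense_all: "iso_dense {A. rooted_tree A}"
  using poset_iso_id by (auto simp: iso_dense_def)

lemma tree_mor_iso: "rooted_tree A \<Longrightarrow> rooted_tree B \<Longrightarrow> poset_iso A B f \<Longrightarrow> tree_mor A B f"
  by (simp add: poset_iso_def tree_mor.emb)

lemma tree_mor_id: "rooted_tree A \<Longrightarrow> tree_mor A A (restrict id (Field A))"
  using tree_mor_iso poset_iso_id by blast

lemma tree_mor_PiE: "tree_mor A B f \<Longrightarrow> f \<in> Field A \<rightarrow>\<^sub>E Field B"
  using tree_mor_mono by blast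

lemma compose_id_right: "f \<in> extensional X \<Longrightarrow> compose X f (restrict id X) = f"
  by (auto simp: compose_def extensional_def fun_eq_iff)

lemma compose_id_left: "f \<in> X \<rightarrow>\<^sub>E Y \<Longrightarrow> compose X (restrict id Y) f = f"
  by (auto simp: compose_def PiE_iff extensional_def fun_eq_iff)

lemma Trees_category:
  assumes "S \<subseteq> {A. rooted_tree A}"
  shows "category (Trees S)"
proof
  fix A B D E f g h
  show "Idn (Trees S) A \<in> Hom (Trees S) A A" if "A \<in> Obj (Trees S)"
    using that assms tree_mor_id by auto
  show "Cmp (Trees S) A B D g f \<in> Hom (Trees S) A D"
    if "f \<in> Hom (Trees S) A B" "g \<in> Hom (Trees S) B D"
    using that tree_mor.comp by simp
  show "Cmp (Trees S) A A B f (Idn (Trees S) A) = f" "Cmp (Trees S) A B B (Idn (Trees S) B) f = f"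
    if "f \<in> Hom (Trees S) A B"
    using tree_mor_PiE[of A B f] that compose_id_right[of f "Field A"] compose_id_left[of f "Field A" "Field B"]
    by (simp_all add: PiE_iff)
  show "Cmp (Trees S) A D E h (Cmp (Trees S) A B D g f) = Cmp (Trees S) A B E (Cmp (Trees S) B D E h g) f"
    if "f \<in> Hom (Trees S) A B" "g \<in> Hom (Trees S) B D"
    using tree_mor_PiE[of A B f] that compose_assoc[of f "Field A" "Field B" h g]
    by (simp add: PiE_def)
qed

lemma Trees_invertible_iff:
  assumes A: "rooted_tree A" and B: "rooted_tree B"
  shows "invertible (Trees S) A B f \<longleftrightarrow> poset_iso A B f"
proof
  assume "invertible (Trees S) A B f"
  then obtain g where f: "tree_mor A B f" and g: "tree_mor B A g"
    and gf: "compose (Field A) g f = restrict id (Field A)"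
    and fg: "compose (Field B) f g = restrict id (Field B)"
    by (auto simp: invertible_def)
  have gf: "g (f x) = x" if "x \<in> Field A" for x
    using fun_cong[OF gf, of x] that by (simp add: compose_def)
  have fg: "f (g x) = x" if "x \<in> Field B" for x
    using fun_cong[OF fg, of x] that by (simp add: compose_def)
  have "embedding A B f"
  proof (rule embeddingI[OF rooted_treeD(2)[OF A] tree_mor_PiE[OF f]])
    show "(f x, f y) \<in> B \<longleftrightarrow> (x, y) \<in> A" if "x \<in> Field A" "y \<in> Field A" for x y
      using tree_mor_mono[OF f] tree_mor_mono[OF g] gf that by metis
  qed
  moreover have "f ` Field A = Field B"
    using tree_mor_PiE[OF f] tree_mor_PiE[OF g] fg by (force simp: image_iff)
  ultimately show "poset_iso A B f" by (simp add: poset_iso_def)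
next
  assume f: "poset_iso A B f"
  then show "invertible (Trees S) A B f"
    using poset_iso_inverse[OF f] tree_mor_iso A B unfolding invertible_def by (metis Trees_simps(2-4) mem_Collect_eq)
qed

lemma Tree_minus_sub: "Tree_minus A B \<subseteq> Hom (Trees S) A B"
  using tree_mor_minus_imp_tree_mor by (auto simp: Tree_minus_def)

lemma Tree_minus_wide:
  assumes "S \<subseteq> {A. rooted_tree A}"
  shows "wide_subcategory (Trees S) Tree_minus"
proof -
  have "tree_mor_minus A A (restrict id (Field A))" if "A \<in> S" for A
    using tree_mor_minus.iso[OF _ _ poset_iso_id] that assms by auto
  then show ?thesis
    unfolding wide_subcategory_def
    by (auto simp: Tree_minus_def tree_mor_minus_imp_tree_mor elim: tree_mor_minus.comp)
qed

text \<open>The complement of \<open>b\<close> need not be a chosen object; it is replaced by an isomorphic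
  one.\<close>

lemma retraction_factors:
  assumes S: "iso_dense S" and A: "rooted_tree A" and ab: "admissible_edge A a b"
  obtains D m s where "D \<in> S" "m \<in> Tree_minus A D" "tree_mor D A s"
    "\<not> poset_iso A D m" "card (Field D) < card (Field A)"
    "compose (Field A) s m = retraction A (a, b)"
proof -
  let ?X = "Field A - {b}"
  let ?B = "Restr A ?X"
  have e: "edge A a b" using ab by (simp add: admissible_edge_def)
  note X = retraction_collapses(1)[OF A e]
  note B = rooted_subset_tree[OF A X]
  obtain D f where D: "D \<in> S" and f: "poset_iso ?B D f"
    using S B(1) unfolding iso_dense_def by blast
  have Dt: "rooted_tree D" using D S by (auto simp: iso_dense_def)
  obtain g where g: "poset_iso D ?B g" "compose (Field ?B) g f = restrict id (Field ?B)"
    using poset_iso_inverse[OF f] by metis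
  let ?r = "retraction A (a, b)" and ?i = "restrict id ?X"
  let ?m = "compose (Field A) f ?r" and ?s = "compose (Field D) ?i g"
  have r: "tree_mor_minus A ?B ?r" by (rule retraction_minus[OF A ab])
  have m: "tree_mor_minus A D ?m"
    using r tree_mor_minus.iso[OF B(1) Dt f] by (rule tree_mor_minus.comp)
  have s: "tree_mor D A ?s"
    using tree_mor_iso[OF Dt B(1) g(1)] tree_mor.emb[OF B(1) A embedding_inclusion[OF A X]]
    by (rule tree_mor.comp)
  have fin: "finite (Field A)" using rooted_treeD(1)[OF A] .
  have "card (Field D) = card ?X"
    using f B(2) card_image[of f ?X] by (auto simp: poset_iso_def embedding_def)
  moreover have "card ?X < card (Field A)"
    using fin edge_in_Field[OF e] by (intro psubset_card_mono) auto
  ultimately have card: "card (Field D) < card (Field A)" by simp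
  then have "\<not> poset_iso A D ?m"
    using card_image[of ?m "Field A"] by (auto simp: poset_iso_def embedding_def)
  moreover have "compose (Field A) ?s ?m = ?r"
  proof
    fix x
    show "compose (Field A) ?s ?m x = ?r x"
    proof (cases "x \<in> Field A")
      case True
      then have rx: "?r x \<in> ?X"
        using tree_mor_PiE[OF tree_mor_minus_imp_tree_mor[OF r]] B(2) by auto
      then have "f (?r x) \<in> Field D" using f B(2) by (auto simp: poset_iso_def)
      moreover have "g (f (?r x)) = ?r x"
        using fun_cong[OF g(2), of "?r x"] rx B(2) by (simp add: compose_def)
      ultimately show ?thesis using True rx by (simp add: compose_def)
    next
      case False
      then show ?thesis by (simp add: compose_def retraction_def)
    qed
  qed
  ultimately show thesis using that[of D ?m ?s] D m s card by (simp add: Tree_minus_def)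
qed

lemma (in cat_module) act_group_hom:
  "x \<in> Obj C \<Longrightarrow> y \<in> Obj C \<Longrightarrow> f \<in> Hom C x y \<Longrightarrow> abelian_group_hom (val M x) (val M y) (act M x y f)"
  using mod_hom_group_hom val_module act_hom by blast

text \<open>The retractions along the admissible edges of \<open>A\<close>, positioned at their upper ends,
  fall under \<open>exists_annihilated\<close>. What they annihilate is annihilated by every
  non-invertible \<open>m\<close> in \<open>Tree_minus\<close>, since \<open>m\<close> factors
  through one of them. Each subtracted element comes from the value of \<open>M\<close> at a
  smaller tree.\<close>

lemma exists_annihilated_by_minus:
  assumes S: "iso_dense S" and M: "cat_module (Trees S) R M" and A: "A \<in> S"
    and u: "u \<in> carrier (val M A)" "P u"
    and step: "\<And>D m s w. D \<in> S \<Longrightarrow> m \<in> Tree_minus A D \<Longrightarrow> \<not> poset_iso A D m \<Longrightarrow>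
      card (Field D) < card (Field A) \<Longrightarrow> tree_mor D A s \<Longrightarrow> w \<in> carrier (val M A) \<Longrightarrow> P w \<Longrightarrow>
      P (w \<ominus>\<^bsub>val M A\<^esub> act M D A s (act M A D m w))"
  shows "\<exists>v \<in> carrier (val M A). P v \<and>
    (\<forall>B \<in> S. \<forall>m \<in> Tree_minus A B. \<not> poset_iso A B m \<longrightarrow> act M A B m v = \<zero>\<^bsub>val M B\<^esub>)"
proof -
  interpret cat_module "Trees S" R M by (rule M)
  have At: "rooted_tree A" using A S by (auto simp: iso_dense_def)
  have A': "A \<in> Obj (Trees S)" using A by simp
  interpret MA: module R "val M A" by (rule val_module[OF A'])
  let ?L = "{(a, b). admissible_edge A a b}"
  let ?p = "\<lambda>e. act M A A (retraction A e)"
  have mor: "tree_mor A A (retraction A e)" if e: "e \<in> ?L" for e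
  proof -
    obtain a b where ab: "e = (a, b)" "admissible_edge A a b" using e by auto
    obtain D m s where "D \<in> S" "m \<in> Tree_minus A D" "tree_mor D A s"
      "compose (Field A) s m = retraction A (a, b)"
      using retraction_factors[OF S At ab(2)] by metis
    then show ?thesis
      using ab(1) tree_mor.comp tree_mor_minus_imp_tree_mor unfolding Tree_minus_def
      by (metis mem_Collect_eq)
  qed
  have cmp: "act M A B g (act M A A f w) = act M A B (compose (Field A) g f) w"
    if "B \<in> S" "tree_mor A A f" "tree_mor A B g" "w \<in> carrier (val M A)" for f g B w
    using act_Cmp[of A A B f g w] that A by simp
  have "\<exists>v \<in> carrier (val M A). P v \<and> (\<forall>e \<in> ?L. ?p e v = \<zero>\<^bsub>val M A\<^esub>)"
  proof (rule exists_annihilated[OF MA.abelian_group_axioms rooted_treeD(2)[OF At], where pos = snd])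
    have "?L \<subseteq> Field A \<times> Field A"
      using edge_in_Field[of A] by (auto simp: admissible_edge_def)
    then show "finite ?L" using rooted_treeD(1)[OF At] finite_subset by blast
    show "abelian_group_hom (val M A) (val M A) (?p e)" if "e \<in> ?L" for e
      using act_group_hom[OF A' A'] mor[OF that] by simp
    show "?p e (?p e w) = ?p e w" if e: "e \<in> ?L" and w: "w \<in> carrier (val M A)" for e w
      using cmp[OF A mor[OF e] mor[OF e] w] retraction_idem[of A "fst e" "snd e"] e by auto
    show "?p e' (?p e (?p e' w)) = ?p e' (?p e w)"
      if e: "e \<in> ?L" and e': "e' \<in> ?L" and ne: "e' \<noteq> e"
        and max: "(snd e, snd e') \<in> A \<Longrightarrow> snd e' = snd e" and w: "w \<in> carrier (val M A)" for e e' w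
    proof -
      have pw: "?p e' w \<in> carrier (val M A)" using act_closed[OF A' A' _ w] mor[OF e'] by simp
      have "compose (Field A) (compose (Field A) (retraction A e') (retraction A e)) (retraction A e')
          = compose (Field A) (retraction A e') (retraction A e)"
        using retraction_braid[OF At, of "fst e" "snd e" "fst e'" "snd e'"] e e' ne max by auto
      then show ?thesis
        using cmp[OF A mor[OF e] mor[OF e'] pw] cmp[OF A mor[OF e] mor[OF e'] w]
          cmp[OF A mor[OF e'] tree_mor.comp[OF mor[OF e] mor[OF e']] w] by simp
    qed
    show "P (w \<ominus>\<^bsub>val M A\<^esub> ?p e w)" if e: "e \<in> ?L" and w: "w \<in> carrier (val M A)" "P w" for e w
    proof -
      obtain a b where ab: "e = (a, b)" "admissible_edge A a b" using e by auto
      obtain D m s where D: "D \<in> S" "m \<in> Tree_minus A D" "tree_mor D A s"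
        "\<not> poset_iso A D m" "card (Field D) < card (Field A)"
        "compose (Field A) s m = retraction A (a, b)"
        using retraction_factors[OF S At ab(2)] by metis
      have "tree_mor A D m" using D(2) tree_mor_minus_imp_tree_mor by (auto simp: Tree_minus_def)
      then have "?p e w = act M D A s (act M A D m w)"
        using act_Cmp[of A D A m s w] D(1,3,6) A w(1) ab(1) by simp
      then show ?thesis using step[OF D(1,2,4,5,3) w] by simp
    qed
  qed (use u in auto)
  then obtain v where v: "v \<in> carrier (val M A)" "P v" "\<And>e. e \<in> ?L \<Longrightarrow> ?p e v = \<zero>\<^bsub>val M A\<^esub>" by blast
  have "act M A B m v = \<zero>\<^bsub>val M B\<^esub>"
    if B: "B \<in> S" and m: "m \<in> Tree_minus A B" and ni: "\<not> poset_iso A B m" for B m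
  proof -
    have m': "tree_mor_minus A B m" using m by (simp add: Tree_minus_def)
    note mm = tree_mor_minus_imp_tree_mor[OF m']
    obtain a b where ab: "admissible_edge A a b" "m a = m b"
      using tree_mor_minus_iso_or_collapse[OF m'] ni by blast
    have e: "(a, b) \<in> ?L" using ab(1) by simp
    have "act M A B m v = act M A B m (?p (a, b) v)"
      using cmp[OF B mor[OF e] mm v(1)] compose_retraction[OF ab] tree_mor_PiE[OF mm]
      by (simp add: PiE_iff)
    also have "\<dots> = \<zero>\<^bsub>val M B\<^esub>"
      using v(3)[OF e] abelian_group_hom.hom_zero[OF act_group_hom[OF A', of B m]] B mm by simp
    finally show ?thesis .
  qed
  then show ?thesis using v(1,2) by blast
qed


section \<open>Projectivity and generation\<close>

text \<open>A morphism from the standard module to \<open>N\<close> is an annihilated element of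
  \<open>N A\<close>. Any preimage of it in \<open>M A\<close> can be corrected to an annihilated
  one without changing its image, because the corrections factor through contractions and so
  vanish in \<open>N\<close>.\<close>

lemma tree_standard_projective:
  fixes S :: "nat rel set" and R :: "('k, 'r) ring_scheme"
  assumes R: "cring R" and S: "iso_dense S" and A: "A \<in> S"
  shows "projective TYPE('m) TYPE('n) (Trees S) R (standard_module (Trees S) Tree_minus R A)"
  unfolding projective_def
proof (intro conjI allI impI)
  let ?T = "Trees S"
  let ?\<Delta> = "standard_module ?T Tree_minus R A" and ?g = "standard_generator ?T Tree_minus R A"
  have trees: "rooted_tree B" if "B \<in> S" for B using that S by (auto simp: iso_dense_def)
  have sub: "S \<subseteq> {A. rooted_tree A}" using S by (simp add: iso_dense_def)
  have cat: "category ?T" by (rule Trees_category[OF sub])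
  have A': "A \<in> Obj ?T" using A by simp
  note C = cat R A' Tree_minus_wide[OF sub]
  show "cat_module ?T R ?\<Delta>" by (rule standard_module_cat_module[OF C])
  fix M :: "(nat rel, nat \<Rightarrow> nat, 'k, 'm) cmod" and N :: "(nat rel, nat \<Rightarrow> nat, 'k, 'n) cmod" and e \<phi>
  assume H: "cat_module ?T R M \<and> cat_module ?T R N \<and> e \<in> nat_trans ?T R M N \<and> epi ?T M N e \<and>
    \<phi> \<in> nat_trans ?T R ?\<Delta> N"
  then have M: "cat_module ?T R M" and N: "cat_module ?T R N" and e: "e \<in> nat_trans ?T R M N"
    and epi: "epi ?T M N e" and \<phi>: "\<phi> \<in> nat_trans ?T R ?\<Delta> N" by blast+
  interpret M: cat_module ?T R M by (rule M)
  interpret N: cat_module ?T R N by (rule N)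
  let ?u = "\<phi> A ?g"
  have "?u \<in> carrier (val N A)" by (rule nat_trans_closed[OF \<phi> A' standard_generator_carrier[OF C]])
  then obtain u where u: "u \<in> carrier (val M A)" "e A u = ?u"
    using epi A' unfolding epi_def by (metis imageE)
  have "\<exists>v \<in> carrier (val M A). e A v = ?u \<and>
    (\<forall>B \<in> S. \<forall>m \<in> Tree_minus A B. \<not> poset_iso A B m \<longrightarrow> act M A B m v = \<zero>\<^bsub>val M B\<^esub>)"
  proof (rule exists_annihilated_by_minus[OF S M A, where P = "\<lambda>w. e A w = ?u", OF u])
    fix D m s w
    assume D: "D \<in> S" and m: "m \<in> Tree_minus A D" and ni: "\<not> poset_iso A D m" and s: "tree_mor D A s"
      and w: "w \<in> carrier (val M A)" "e A w = ?u"
    have mm: "m \<in> Hom ?T A D" and ss: "s \<in> Hom ?T D A" and D': "D \<in> Obj ?T"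
      using m s D Tree_minus_sub by auto
    interpret eA: abelian_group_hom "val M A" "val N A" "e A"
      using mod_hom_group_hom[OF M.val_module[OF A'] N.val_module[OF A'] nat_transD(1)[OF e A']] .
    note mw = M.act_closed[OF A' D' mm w(1)]
    note smw = M.act_closed[OF D' A' ss mw]
    have "e A (act M D A s (act M A D m w)) = act N D A s (act N A D m ?u)"
      using nat_transD(2)[OF e D' A' ss mw] nat_transD(2)[OF e A' D' mm w(1)] w(2) by simp
    also have "act N A D m ?u = \<zero>\<^bsub>val N D\<^esub>"
      by (rule standard_generator_killed[OF C N \<phi> D' m]) (simp add: Trees_invertible_iff trees A D ni)
    also have "act N D A s \<zero>\<^bsub>val N D\<^esub> = \<zero>\<^bsub>val N A\<^esub>"
      by (rule abelian_group_hom.hom_zero[OF N.act_group_hom[OF D' A' ss]])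
    finally show "e A (w \<ominus>\<^bsub>val M A\<^esub> act M D A s (act M A D m w)) = ?u"
      using w smw eA.hom_closed[OF w(1)] by (simp add: eA.G.minus_eq eA.H.minus_eq)
  qed
  then obtain v where v: "v \<in> carrier (val M A)" "e A v = ?u"
    "\<And>B m. B \<in> S \<Longrightarrow> m \<in> Tree_minus A B \<Longrightarrow> \<not> poset_iso A B m \<Longrightarrow> act M A B m v = \<zero>\<^bsub>val M B\<^esub>"
    by blast
  obtain \<psi> where \<psi>: "\<psi> \<in> nat_trans ?T R ?\<Delta> M" "\<psi> A ?g = v"
  proof (rule standard_hom_exists[OF C M v(1)])
    fix B m assume B: "B \<in> Obj ?T" "m \<in> Tree_minus A B" "\<not> invertible ?T A B m"
    then show "act M A B m v = \<zero>\<^bsub>val M B\<^esub>"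
      using v(3)[of B m] Trees_invertible_iff[OF trees[OF A] trees, of B] by simp
  qed
  have "e B (\<psi> B U) = \<phi> B U" if "B \<in> Obj ?T" "U \<in> carrier (val ?\<Delta> B)" for B U
    by (rule standard_hom_eqI[OF C N nat_trans_compose[OF \<psi>(1) e] \<phi> _ that]) (simp add: \<psi>(2) v(2))
  then show "\<exists>\<psi> \<in> nat_trans ?T R ?\<Delta> M. \<forall>B \<in> Obj ?T. \<forall>U \<in> carrier (val ?\<Delta> B). e B (\<psi> B U) = \<phi> B U"
    using \<psi>(1) by blast
qed

text \<open>Two distinct parallel morphisms are compared at a smallest tree where they differ. There they
  agree on all elements coming from smaller trees, so correcting an element on which they differ
  preserves the difference, and the corrected element is the image of the generator of a standard
  module.\<close>

lemma tree_standard_generating: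
  fixes S :: "nat rel set" and R :: "('k, 'r) ring_scheme"
  assumes R: "cring R" and S: "iso_dense S"
  shows "generating_family TYPE('m) TYPE('n) (Trees S) R (Obj (Trees S)) (standard_module (Trees S) Tree_minus R)"
  unfolding generating_family_def
proof (intro conjI allI impI ballI)
  let ?T = "Trees S"
  have trees: "rooted_tree B" if "B \<in> S" for B using that S by (auto simp: iso_dense_def)
  have sub: "S \<subseteq> {A. rooted_tree A}" using S by (simp add: iso_dense_def)
  have cat: "category ?T" by (rule Trees_category[OF sub])
  show "cat_module ?T R (standard_module ?T Tree_minus R A)" if "A \<in> Obj ?T" for A
    by (rule standard_module_cat_module[OF cat R that Tree_minus_wide[OF sub]])
  fix M :: "(nat rel, nat \<Rightarrow> nat, 'k, 'm) cmod" and N :: "(nat rel, nat \<Rightarrow> nat, 'k, 'n) cmod" and \<phi> \<psi>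
  assume H: "cat_module ?T R M \<and> cat_module ?T R N \<and> \<phi> \<in> nat_trans ?T R M N \<and> \<psi> \<in> nat_trans ?T R M N \<and>
    (\<exists>A \<in> Obj ?T. \<exists>u \<in> carrier (val M A). \<phi> A u \<noteq> \<psi> A u)"
  then have M: "cat_module ?T R M" and N: "cat_module ?T R N"
    and \<phi>: "\<phi> \<in> nat_trans ?T R M N" and \<psi>: "\<psi> \<in> nat_trans ?T R M N" by blast+
  interpret M: cat_module ?T R M by (rule M)
  interpret N: cat_module ?T R N by (rule N)
  let ?Q = "\<lambda>A. A \<in> S \<and> (\<exists>u \<in> carrier (val M A). \<phi> A u \<noteq> \<psi> A u)"
  obtain A\<^sub>0 where "?Q A\<^sub>0" using H by auto
  then obtain A where A: "?Q A" and least: "\<And>D. ?Q D \<Longrightarrow> card (Field A) \<le> card (Field D)"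
    using ex_has_least_nat[of ?Q A\<^sub>0 "\<lambda>A. card (Field A)"] by blast
  then obtain u where u: "u \<in> carrier (val M A)" "\<phi> A u \<noteq> \<psi> A u" by blast
  have AS: "A \<in> S" and A': "A \<in> Obj ?T" using A by auto
  note C = cat R A' Tree_minus_wide[OF sub]
  let ?\<Delta> = "standard_module ?T Tree_minus R A" and ?g = "standard_generator ?T Tree_minus R A"
  have "\<exists>v \<in> carrier (val M A). \<phi> A v \<noteq> \<psi> A v \<and>
    (\<forall>B \<in> S. \<forall>m \<in> Tree_minus A B. \<not> poset_iso A B m \<longrightarrow> act M A B m v = \<zero>\<^bsub>val M B\<^esub>)"
  proof (rule exists_annihilated_by_minus[OF S M AS, where P = "\<lambda>w. \<phi> A w \<noteq> \<psi> A w", OF u])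
    fix D m s w
    assume D: "D \<in> S" and m: "m \<in> Tree_minus A D" and less: "card (Field D) < card (Field A)"
      and s: "tree_mor D A s" and w: "w \<in> carrier (val M A)" "\<phi> A w \<noteq> \<psi> A w"
    have mm: "m \<in> Hom ?T A D" and ss: "s \<in> Hom ?T D A" and D': "D \<in> Obj ?T"
      using m s D Tree_minus_sub by auto
    interpret \<phi>A: abelian_group_hom "val M A" "val N A" "\<phi> A"
      using mod_hom_group_hom[OF M.val_module[OF A'] N.val_module[OF A'] nat_transD(1)[OF \<phi> A']] .
    interpret \<psi>A: abelian_group_hom "val M A" "val N A" "\<psi> A"
      using mod_hom_group_hom[OF M.val_module[OF A'] N.val_module[OF A'] nat_transD(1)[OF \<psi> A']] .
    note mw = M.act_closed[OF A' D' mm w(1)]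
    note smw = M.act_closed[OF D' A' ss mw]
    have "\<phi> D (act M A D m w) = \<psi> D (act M A D m w)"
      using least[of D] less D mw by fastforce
    then have eq: "\<phi> A (act M D A s (act M A D m w)) = \<psi> A (act M D A s (act M A D m w))"
      using nat_transD(2)[OF \<phi> D' A' ss mw] nat_transD(2)[OF \<psi> D' A' ss mw] by simp
    show "\<phi> A (w \<ominus>\<^bsub>val M A\<^esub> act M D A s (act M A D m w))
        \<noteq> \<psi> A (w \<ominus>\<^bsub>val M A\<^esub> act M D A s (act M A D m w))"
      using w smw eq \<psi>A.hom_closed[OF smw] \<phi>A.hom_closed[OF w(1)] \<psi>A.hom_closed[OF w(1)]
      by (simp add: \<phi>A.G.minus_eq)
  qed
  then obtain v where v: "v \<in> carrier (val M A)" "\<phi> A v \<noteq> \<psi> A v"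
    "\<And>B m. B \<in> S \<Longrightarrow> m \<in> Tree_minus A B \<Longrightarrow> \<not> poset_iso A B m \<Longrightarrow> act M A B m v = \<zero>\<^bsub>val M B\<^esub>"
    by blast
  obtain h where h: "h \<in> nat_trans ?T R ?\<Delta> M" "h A ?g = v"
  proof (rule standard_hom_exists[OF C M v(1)])
    fix B m assume B: "B \<in> Obj ?T" "m \<in> Tree_minus A B" "\<not> invertible ?T A B m"
    then show "act M A B m v = \<zero>\<^bsub>val M B\<^esub>"
      using v(3)[of B m] Trees_invertible_iff[OF trees[OF AS] trees, of B] by simp
  qed
  have g: "?g \<in> carrier (val ?\<Delta> A)" by (rule standard_generator_carrier[OF C])
  have "\<phi> A (h A ?g) \<noteq> \<psi> A (h A ?g)" using v(2) h(2) by simp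
  then show "\<exists>A \<in> Obj ?T. \<exists>h \<in> nat_trans ?T R (standard_module ?T Tree_minus R A) M.
      \<exists>B \<in> Obj ?T. \<exists>U \<in> carrier (val (standard_module ?T Tree_minus R A) B). \<phi> B (h B U) \<noteq> \<psi> B (h B U)"
    by (intro bexI[OF _ A'] bexI[OF _ h(1)] bexI[OF _ g])
qed


section \<open>The Reedy structure\<close>

lemma skeleton_iso_dense:
  assumes "skeleton Tree_cat S"
  shows "iso_dense S"
    and "\<And>A B f. A \<in> S \<Longrightarrow> B \<in> S \<Longrightarrow> poset_iso A B f \<Longrightarrow> A = B"
proof -
  have iso: "isomorphic Tree_cat A B \<longleftrightarrow> (\<exists>f. poset_iso A B f)" if "rooted_tree A" "rooted_tree B" for A B
    using Trees_invertible_iff[OF that] arg_cong[OF Tree_cat_eq, of "\<lambda>C. isomorphic C A B"]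
    by (simp add: isomorphic_def)
  have sub: "S \<subseteq> {A. rooted_tree A}" and ex: "\<And>A. rooted_tree A \<Longrightarrow> \<exists>!B. B \<in> S \<and> isomorphic Tree_cat A B"
    using assms by (auto simp: skeleton_def Tree_cat_def)
  show "iso_dense S"
    unfolding iso_dense_def using sub ex iso by (metis mem_Collect_eq subset_iff)
  show "A = B" if "A \<in> S" "B \<in> S" "poset_iso A B f" for A B f
    using that sub ex[of A] iso poset_iso_id[of A] by blast
qed

lemma tree_factorization:
  assumes S: "iso_dense S" and A: "A \<in> S" and f: "tree_mor A B f"
  shows "\<exists>D \<in> S. \<exists>p \<in> Tree_plus D B. \<exists>m \<in> Tree_minus A D. f = compose (Field A) p m"
proof -
  let ?X = "f ` Field A"
  have B: "rooted_tree B" using tree_mor_mono[OF f] by blast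
  note X = tree_mor_image[OF f]
  note I = rooted_subset_tree[OF B X]
  obtain D \<alpha> where D: "D \<in> S" and \<alpha>: "poset_iso (Restr B ?X) D \<alpha>"
    using S I(1) unfolding iso_dense_def by blast
  have Dt: "rooted_tree D" using D S by (auto simp: iso_dense_def)
  obtain \<beta> where \<beta>: "poset_iso D (Restr B ?X) \<beta>"
    "compose (Field (Restr B ?X)) \<beta> \<alpha> = restrict id (Field (Restr B ?X))"
    using poset_iso_inverse[OF \<alpha>] by metis
  let ?p = "compose (Field D) (restrict id ?X) \<beta>" and ?m = "compose (Field A) \<alpha> f"
  have "embedding D B ?p"
    by (rule embedding_compose[OF _ embedding_inclusion[OF B X]]) (use \<beta>(1) in \<open>simp add: poset_iso_def\<close>)
  then have "?p \<in> Tree_plus D B" using Dt B by (simp add: Tree_plus_def)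
  moreover have "?m \<in> Tree_minus A D"
    using tree_mor_minus.comp[OF tree_mor_onto_image[OF f] tree_mor_minus.iso[OF I(1) Dt \<alpha>]]
    by (simp add: Tree_minus_def)
  moreover have "f x = compose (Field A) ?p ?m x" for x
  proof (cases "x \<in> Field A")
    case True
    then have "\<alpha> (f x) \<in> Field D" using \<alpha> I(2) by (auto simp: poset_iso_def)
    moreover have "\<beta> (\<alpha> (f x)) = f x"
      using fun_cong[OF \<beta>(2), of "f x"] True I(2) by (simp add: compose_def)
    ultimately show ?thesis using True by (simp add: compose_def)
  next
    case False
    then show ?thesis using tree_mor_PiE[OF f] by (auto simp: compose_def PiE_iff extensional_def)
  qed
  then have "f = compose (Field A) ?p ?m" by blast
  ultimately show ?thesis using D by blast
qed

text \<open>Both intermediate trees are copies of the image of the composite.\<close>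

lemma tree_factorization_unique:
  assumes p: "p \<in> Tree_plus D B" and m: "m \<in> Tree_minus A D"
    and p': "p' \<in> Tree_plus D' B" and m': "m' \<in> Tree_minus A D'"
    and eq: "compose (Field A) p m = compose (Field A) p' m'"
  shows "\<exists>s. poset_iso D D' s \<and> m' = compose (Field A) s m \<and> p = compose (Field D) p' s"
proof -
  let ?f = "compose (Field A) p m"
  have emb: "embedding D B p" "embedding D' B p'" using p p' by (auto simp: Tree_plus_def)
  have surj: "m ` Field A = Field D" "m' ` Field A = Field D'"
    using tree_mor_minus_surj[of A D m] tree_mor_minus_surj[of A D' m'] m m' by (simp_all add: Tree_minus_def)
  have ext: "m \<in> Field A \<rightarrow>\<^sub>E Field D" "m' \<in> Field A \<rightarrow>\<^sub>E Field D'"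
    using m m' tree_mor_PiE[OF tree_mor_minus_imp_tree_mor] by (auto simp: Tree_minus_def)
  have pm: "p (m x) = p' (m' x)" if "x \<in> Field A" for x
    using fun_cong[OF eq, of x] that by (simp add: compose_def)
  define s where "s = restrict (\<lambda>d. inv_into (Field D') p' (p d)) (Field D)"
  have s_m: "s (m x) = m' x" if "x \<in> Field A" for x
  proof -
    have "m x \<in> Field D" "m' x \<in> Field D'" using that surj by auto
    then show ?thesis
      using pm[OF that] emb(2) by (simp add: s_def embedding_def)
  qed
  have sD: "s d \<in> Field D'" "p' (s d) = p d" if d: "d \<in> Field D" for d
  proof -
    obtain x where x: "x \<in> Field A" "d = m x" using d surj(1) by blast
    show "s d \<in> Field D'" "p' (s d) = p d"
      using s_m[OF x(1)] pm[OF x(1)] x surj(2) by auto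
  qed
  have p_iff: "(p x, p y) \<in> B \<longleftrightarrow> (x, y) \<in> D" if "x \<in> Field D" "y \<in> Field D" for x y
    using emb(1) that by (simp add: embedding_def)
  have p'_iff: "(p' x, p' y) \<in> B \<longleftrightarrow> (x, y) \<in> D'" if "x \<in> Field D'" "y \<in> Field D'" for x y
    using emb(2) that by (simp add: embedding_def)
  have "embedding D D' s"
  proof (rule embeddingI)
    show "Partial_order D" using p rooted_treeD(2) by (auto simp: Tree_plus_def)
    show "s \<in> Field D \<rightarrow>\<^sub>E Field D'" using sD(1) by (intro PiE_I) (auto simp: s_def)
    show "(s x, s y) \<in> D' \<longleftrightarrow> (x, y) \<in> D" if "x \<in> Field D" "y \<in> Field D" for x y
      using p_iff[OF that] p'_iff[OF sD(1)[OF that(1)] sD(1)[OF that(2)]]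
        sD(2)[OF that(1)] sD(2)[OF that(2)] by metis
  qed
  moreover have "s ` Field D = Field D'"
  proof -
    have "s ` m ` Field A = m' ` Field A" unfolding image_image using s_m by (rule image_cong[OF refl])
    then show ?thesis unfolding surj .
  qed
  ultimately have "poset_iso D D' s" by (simp add: poset_iso_def)
  moreover have "m' x = compose (Field A) s m x" for x
    using s_m[of x] ext(2) by (cases "x \<in> Field A") (simp_all add: compose_def PiE_iff extensional_def)
  moreover have "p d = compose (Field D) p' s d" for d
    using sD(2)[of d] emb(1)
    by (cases "d \<in> Field D") (simp_all add: compose_def embedding_def PiE_iff extensional_def)
  ultimately show ?thesis by blast
qed

lemma embedding_id: "embedding A A (restrict id (Field A))"
  by (auto simp: embedding_def inj_on_def)

lemma tree_reedy:
  assumes "skeleton Tree_cat S"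
  shows "generalized_reedy (Trees S) tree_degree Tree_plus Tree_minus"
proof -
  note S = skeleton_iso_dense(1)[OF assms] and eq = skeleton_iso_dense(2)[OF assms]
  have trees: "rooted_tree A" if "A \<in> S" for A using that S by (auto simp: iso_dense_def)
  have sub: "S \<subseteq> {A. rooted_tree A}" using S by (simp add: iso_dense_def)
  have cat: "category (Trees S)" by (rule Trees_category[OF sub])
  have inv: "invertible (Trees S) A B f \<longleftrightarrow> poset_iso A B f" if "A \<in> S" "B \<in> S" for A B f
    using Trees_invertible_iff trees that by blast
  have aut: "f \<in> Aut (Trees S) A \<longleftrightarrow> poset_iso A A f" if "A \<in> S" for A f
    using inv that by (simp add: Aut_def)
  have skel: "skeletal (Trees S)"
    unfolding skeletal_def isomorphic_def Trees_simps using inv eq by blast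
  have plus_wide: "wide_subcategory (Trees S) Tree_plus"
    unfolding wide_subcategory_def
    using trees by (auto simp: Tree_plus_def embedding_id intro: tree_mor.emb elim: embedding_compose)
  have minus_wide: "wide_subcategory (Trees S) Tree_minus" by (rule Tree_minus_wide[OF sub])
  have plus_degree: "A = B \<or> tree_degree A < tree_degree B" if "A \<in> S" "B \<in> S" "Tree_plus A B \<noteq> {}" for A B
    using that embedding_card eq by (fastforce simp: Tree_plus_def tree_degree_def)
  have minus_degree: "A = B \<or> tree_degree B < tree_degree A" if "A \<in> S" "B \<in> S" "Tree_minus A B \<noteq> {}" for A B
    using that tree_mor_minus_card eq by (fastforce simp: Tree_minus_def tree_degree_def)
  have plus_aut: "Tree_plus A A = Aut (Trees S) A" if A: "A \<in> S" for A
    using aut[OF A] trees[OF A] embedding_card[of A A]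
    by (auto simp: Tree_plus_def poset_iso_def)
  have minus_aut: "Tree_minus A A = Aut (Trees S) A" if A: "A \<in> S" for A
    using aut[OF A] trees[OF A] tree_mor_minus_card[of A A] tree_mor_minus.iso[of A A]
    by (auto simp: Tree_minus_def)
  have factor: "\<exists>D \<in> S. \<exists>p \<in> Tree_plus D B. \<exists>m \<in> Tree_minus A D. f = compose (Field A) p m"
    if "A \<in> S" "tree_mor A B f" for A B f
    using tree_factorization[OF S that] .
  have unique: "D = D' \<and> (\<exists>s \<in> Aut (Trees S) D. m' = compose (Field A) s m \<and> p = compose (Field D) p' s)"
    if D: "D \<in> S" "D' \<in> S" and pm: "p \<in> Tree_plus D B" "m \<in> Tree_minus A D" "p' \<in> Tree_plus D' B"
      "m' \<in> Tree_minus A D'" and f: "f = compose (Field A) p m \<and> f = compose (Field A) p' m'"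
    for A B D D' p m p' m' f
  proof -
    obtain s where s: "poset_iso D D' s" "m' = compose (Field A) s m" "p = compose (Field D) p' s"
      using tree_factorization_unique[OF pm] f by auto
    have "D = D'" using eq D s(1) by blast
    then show ?thesis using s aut[OF D(1)] by blast
  qed
  show ?thesis
    unfolding generalized_reedy_def Trees_simps
  proof (intro conjI[OF cat] conjI[OF skel] conjI[OF plus_wide] conjI[OF minus_wide] conjI ballI impI)
    show "A = B \<or> tree_degree A < tree_degree B" if "A \<in> S" "B \<in> S" "Tree_plus A B \<noteq> {}" for A B
      using plus_degree that .
    show "A = B \<or> tree_degree B < tree_degree A" if "A \<in> S" "B \<in> S" "Tree_minus A B \<noteq> {}" for A B
      using minus_degree that .
    show "\<exists>D \<in> S. \<exists>p \<in> Tree_plus D B. \<exists>m \<in> Tree_minus A D. f = compose (Field A) p m"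
      if "A \<in> S" "f \<in> {f. tree_mor A B f}" for A B f
      using factor[OF that(1)] that(2) by simp
  qed (use plus_aut minus_aut unique in auto)
qed

theorem theorem1p3:
  fixes k :: "('k, 'r) ring_scheme" and S :: "nat rel set"
  assumes "cring k"
    and "skeleton Tree_cat S"
  shows "generalized_reedy (full_subcat Tree_cat S) tree_degree Tree_plus Tree_minus \<and>
    (\<forall>T \<in> {Tree_cat, full_subcat Tree_cat S}.
       projective_generators TYPE('m) TYPE('n) T k (Obj T) (standard_module T Tree_minus k))"
proof -
  have gen: "projective_generators TYPE('m) TYPE('n) (Trees O') k (Obj (Trees O'))
      (standard_module (Trees O') Tree_minus k)" if "iso_dense O'" for O'
    unfolding projective_generators_def
    by (intro conjI ballI tree_standard_generating[OF assms(1) that] tree_standard_projective[OF assms(1) that])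
      simp
  have "projective_generators TYPE('m) TYPE('n) Tree_cat k (Obj Tree_cat) (standard_module Tree_cat Tree_minus k)"
    using gen[OF iso_dense_all] unfolding Tree_cat_eq[symmetric] .
  then show ?thesis
    using tree_reedy[OF assms(2)] gen[OF skeleton_iso_dense(1)[OF assms(2)]] by blast
qed

end
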